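(* Let $n>1$ be a natural number, let $H_n$ be Houghton's group, and let $|\mathcal{M}|$ be the geometric realisation of the poset $(\mathcal{M},\le)$ of eventually-translation injections described in the context, with its action of $H_n$. Then $|\mathcal{M}|$ is a model for $\mathrm{E}_{\mathfrak{Fin}}H_n$, the classifying space for proper actions of $H_n$.
   Context: Let $S=\mathbb{N}\times\{1,\dots,n\}$. A map $h:S\to S$ is eventually a translation if there are $(z_1,\dots,z_n)\in\mathbb{N}^n$ and $(m_1,\dots,m_n)\in\mathbb{Z}^n$ such that $h$ sends $(i,x)$ to $(i+m_x,x)$ for all $x\in\{1,\dots,n\}$ and all $i\ge z_x$. Houghton's group $H_n$ is the group of all permutations of $S$ that are eventually translations. Maps are written on the right, so $\alpha\beta$ means first $\alpha$, then $\beta$. $\mathcal{M}$ is the monoid of all injective maps $S\to S$ that are eventually translations. $T\subseteq\mathcal{M}$ is the submonoid generated by $t_1,\dots,t_n$, where $(i,x)t_y=(i+1,x)$ if $x=y$ and $(i,x)t_y=(i,x)$ if $x\ne y$. The partial order on $\mathcal{M}$ is: $\alpha\le\beta$ if and only if $\beta=t\alpha$ for some $t\in T$. $H_n$ acts on $\mathcal{M}$ by right multiplication, preserving the order, hence acts on the geometric realisation $|\mathcal{M}|$ (the simplicial complex whose simplices are the finite chains in $\mathcal{M}$). A model for $\mathrm{E}_{\mathfrak{Fin}}G$ is a $G$-CW-complex $X$ with all isotropy groups finite and such that $X^Q$ is contractible for every finite subgroup $Q\le G$. *)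

theory Defs
  imports "HOL-Analysis.Analysis" "HOL-Algebra.Coset" "HOL-Algebra.Bij"
begin

section \<open>Houghton's group and the poset of eventually translating injections\<close>

type_synonym point = "nat \<times> nat"

definition rays :: "nat \<Rightarrow> point set" where
  "rays n = UNIV \<times> {1..n}"

text \<open>The equation for the first coordinate is stated in the integers, so that a negative
  \<open>m x\<close> is not truncated.\<close>

definition eventually_translation :: "nat \<Rightarrow> (point \<Rightarrow> point) \<Rightarrow> bool" where
  "eventually_translation n h \<longleftrightarrow>
     (\<exists>(z :: nat \<Rightarrow> nat) (m :: nat \<Rightarrow> int). \<forall>x\<in>{1..n}. \<forall>i\<ge>z x.
        int (fst (h (i, x))) = int i + m x \<and> snd (h (i, x)) = x)"

text \<open>Self-maps of \<open>rays n\<close> are represented by functions that are \<open>undefined\<close> outside \<open>rays n\<close>.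
  Maps act on the right, so the product of \<open>\<alpha>\<close> and \<open>\<beta>\<close> is first \<open>\<alpha>\<close>, then \<open>\<beta>\<close>.\<close>

definition injection_monoid :: "nat \<Rightarrow> (point \<Rightarrow> point) monoid" where
  "injection_monoid n =
     \<lparr>carrier = {h \<in> rays n \<rightarrow>\<^sub>E rays n. inj_on h (rays n) \<and> eventually_translation n h},
      mult = (\<lambda>\<alpha> \<beta>. compose (rays n) \<beta> \<alpha>),
      one = (\<lambda>p\<in>rays n. p)\<rparr>"

definition houghton_group :: "nat \<Rightarrow> (point \<Rightarrow> point) monoid" where
  "houghton_group n =
     \<lparr>carrier = {h \<in> Bij (rays n). eventually_translation n h},
      mult = (\<lambda>\<alpha> \<beta>. compose (rays n) \<beta> \<alpha>),
      one = (\<lambda>p\<in>rays n. p)\<rparr>"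

definition ray_shift :: "nat \<Rightarrow> nat \<Rightarrow> point \<Rightarrow> point" where
  "ray_shift n y = (\<lambda>(i, x)\<in>rays n. (if x = y then i + 1 else i, x))"

definition translation_monoid :: "nat \<Rightarrow> (point \<Rightarrow> point) set" where
  "translation_monoid n =
     (\<lambda>H. submonoid H (injection_monoid n)) hull (ray_shift n ` {1..n})"

definition injection_order :: "nat \<Rightarrow> ((point \<Rightarrow> point) \<times> (point \<Rightarrow> point)) set" where
  "injection_order n =
     {(\<alpha>, \<beta>). \<alpha> \<in> carrier (injection_monoid n) \<and> \<beta> \<in> carrier (injection_monoid n) \<and>
        (\<exists>t\<in>translation_monoid n. \<beta> = t \<otimes>\<^bsub>injection_monoid n\<^esub> \<alpha>)}"


section \<open>Geometric realisation\<close>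

text \<open>Points are given by barycentric coordinates.  On a single finite simplex the product topology
  of the function space is the Euclidean topology; the realisation carries the weak topology with
  respect to its simplices.\<close>

definition geometric_simplex :: "'v set \<Rightarrow> ('v \<Rightarrow> real) set" where
  "geometric_simplex \<sigma> = {f. (\<forall>v. 0 \<le> f v) \<and> (\<forall>v. v \<notin> \<sigma> \<longrightarrow> f v = 0) \<and> (\<Sum>v\<in>\<sigma>. f v) = 1}"

definition geometric_realisation :: "'v set set \<Rightarrow> ('v \<Rightarrow> real) topology" where
  "geometric_realisation K =
     topology (\<lambda>U. U \<subseteq> \<Union> (geometric_simplex ` K) \<and>
       (\<forall>\<sigma>\<in>K. openin (top_of_set (geometric_simplex \<sigma>)) (U \<inter> geometric_simplex \<sigma>)))"

lemma openin_geometric_realisation: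
  "openin (geometric_realisation K) U \<longleftrightarrow>
     U \<subseteq> \<Union> (geometric_simplex ` K) \<and>
     (\<forall>\<sigma>\<in>K. openin (top_of_set (geometric_simplex \<sigma>)) (U \<inter> geometric_simplex \<sigma>))"
proof -
  have 1: "(S \<inter> T) \<inter> A = (S \<inter> A) \<inter> (T \<inter> A)" for S T A :: "('a \<Rightarrow> real) set"
    by blast
  have 2: "\<Union> \<K> \<inter> A = (\<Union>S\<in>\<K>. S \<inter> A)" for \<K> and A :: "('a \<Rightarrow> real) set"
    by blast
  have "istopology (\<lambda>U. U \<subseteq> \<Union> (geometric_simplex ` K) \<and>
       (\<forall>\<sigma>\<in>K. openin (top_of_set (geometric_simplex \<sigma>)) (U \<inter> geometric_simplex \<sigma>)))"
    unfolding istopology_def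
  proof (intro conjI allI impI ballI)
    fix S T \<sigma>
    assume "S \<subseteq> \<Union> (geometric_simplex ` K) \<and>
        (\<forall>\<sigma>\<in>K. openin (top_of_set (geometric_simplex \<sigma>)) (S \<inter> geometric_simplex \<sigma>))"
      and "T \<subseteq> \<Union> (geometric_simplex ` K) \<and>
        (\<forall>\<sigma>\<in>K. openin (top_of_set (geometric_simplex \<sigma>)) (T \<inter> geometric_simplex \<sigma>))"
      and "\<sigma> \<in> K"
    then show "openin (top_of_set (geometric_simplex \<sigma>)) (S \<inter> T \<inter> geometric_simplex \<sigma>)"
      by (subst 1) (blast intro: openin_Int)
  next
    fix \<K> \<sigma>
    assume "\<forall>S\<in>\<K>. S \<subseteq> \<Union> (geometric_simplex ` K) \<and>
        (\<forall>\<sigma>\<in>K. openin (top_of_set (geometric_simplex \<sigma>)) (S \<inter> geometric_simplex \<sigma>))"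
      and "\<sigma> \<in> K"
    then show "openin (top_of_set (geometric_simplex \<sigma>)) (\<Union> \<K> \<inter> geometric_simplex \<sigma>)"
      by (subst 2) (blast intro: openin_Union)
  qed blast+
  then show ?thesis
    by (simp only: geometric_realisation_def topology_inverse')
qed

text \<open>Elements of a chain of \<open>r\<close> are related to themselves, hence lie in the field of \<open>r\<close>.\<close>

definition order_complex :: "('v \<times> 'v) set \<Rightarrow> 'v set set" where
  "order_complex r = {C \<in> Chains r. finite C \<and> C \<noteq> {}}"

text \<open>The map of realisations that is affine on simplices and given by \<open>\<phi>\<close> on vertices.\<close>

definition affine_extension :: "('v \<Rightarrow> 'w) \<Rightarrow> ('v \<Rightarrow> real) \<Rightarrow> 'w \<Rightarrow> real" where
  "affine_extension \<phi> f = (\<lambda>w. \<Sum>v | f v \<noteq> 0 \<and> \<phi> v = w. f v)"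

definition poset_realisation :: "nat \<Rightarrow> ((point \<Rightarrow> point) \<Rightarrow> real) topology" where
  "poset_realisation n = geometric_realisation (order_complex (injection_order n))"

definition poset_realisation_action ::
    "nat \<Rightarrow> ((point \<Rightarrow> point) \<Rightarrow> real) \<Rightarrow> (point \<Rightarrow> point) \<Rightarrow> ((point \<Rightarrow> point) \<Rightarrow> real)" where
  "poset_realisation_action n f g =
     affine_extension (\<lambda>\<alpha>. \<alpha> \<otimes>\<^bsub>injection_monoid n\<^esub> g) f"


section \<open>Equivariant CW-complexes for a discrete group acting on the right\<close>

definition right_G_space ::
    "('g, 'm) monoid_scheme \<Rightarrow> 'x topology \<Rightarrow> ('x \<Rightarrow> 'g \<Rightarrow> 'x) \<Rightarrow> bool" where
  "right_G_space G X act \<longleftrightarrow>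
     group G \<and>
     (\<forall>g\<in>carrier G. continuous_map X X (\<lambda>x. act x g)) \<and>
     (\<forall>x\<in>topspace X. act x \<one>\<^bsub>G\<^esub> = x) \<and>
     (\<forall>x\<in>topspace X. \<forall>g\<in>carrier G. \<forall>h\<in>carrier G. act x (g \<otimes>\<^bsub>G\<^esub> h) = act (act x g) h)"

definition unit_disc :: "nat \<Rightarrow> (nat \<Rightarrow> real) topology" where
  "unit_disc k = subtopology (Euclidean_space k) {x. (\<Sum>i<k. x i ^ 2) \<le> 1}"

definition disc_boundary :: "nat \<Rightarrow> (nat \<Rightarrow> real) set" where
  "disc_boundary k = {x \<in> topspace (unit_disc k). (\<Sum>i<k. x i ^ 2) = 1}"

text \<open>The coproduct over \<open>i \<in> I\<close> of \<open>H\<^sub>i\G \<times> D\<^sup>k\<close>, where \<open>H\<^sub>i\G\<close> is the discrete right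
  \<open>G\<close>-set of cosets \<open>H\<^sub>i g\<close>.\<close>

definition equivariant_discs ::
    "('g, 'm) monoid_scheme \<Rightarrow> nat \<Rightarrow> 'i set \<Rightarrow> ('i \<Rightarrow> 'g set) \<Rightarrow>
      ('i \<times> 'g set \<times> (nat \<Rightarrow> real)) topology" where
  "equivariant_discs G k I H =
     sum_topology
       (\<lambda>i. prod_topology (discrete_topology (rcosets\<^bsub>G\<^esub> (H i))) (unit_disc k)) I"

definition equivariant_spheres ::
    "('g, 'm) monoid_scheme \<Rightarrow> nat \<Rightarrow> 'i set \<Rightarrow> ('i \<Rightarrow> 'g set) \<Rightarrow>
      ('i \<times> 'g set \<times> (nat \<Rightarrow> real)) set" where
  "equivariant_spheres G k I H = (SIGMA i:I. (rcosets\<^bsub>G\<^esub> (H i)) \<times> disc_boundary k)"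

text \<open>The subspace \<open>B\<close> is obtained from \<open>A\<close> by attaching equivariant \<open>k\<close>-cells: there is a pushout
  of right \<open>G\<close>-spaces whose corners are the coproduct of the \<open>H\<^sub>i\G \<times> S\<^sup>k\<^sup>-\<^sup>1\<close>, the coproduct
  of the \<open>H\<^sub>i\G \<times> D\<^sup>k\<close>, \<open>A\<close> and \<open>B\<close>.  The pushout property is spelt out as the gluing of sets
  together with the final topology.  It is no restriction that cells are indexed by points of the
  space, since an equivariant cell is determined by the image of \<open>(H\<^sub>i, 0)\<close>.\<close>

definition attaches_equivariant_cells ::
    "('g, 'm) monoid_scheme \<Rightarrow> 'x topology \<Rightarrow> ('x \<Rightarrow> 'g \<Rightarrow> 'x) \<Rightarrow> nat \<Rightarrow>
      'x set \<Rightarrow> 'x set \<Rightarrow> bool" where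
  "attaches_equivariant_cells G X act k A B \<longleftrightarrow>
     A \<subseteq> B \<and>
     (\<exists>(I :: 'x set) H Q.
        (\<forall>i\<in>I. subgroup (H i) G) \<and>
        continuous_map (equivariant_discs G k I H) (subtopology X B) Q \<and>
        (\<forall>(i, c, d)\<in>topspace (equivariant_discs G k I H). \<forall>g\<in>carrier G.
           Q (i, c #>\<^bsub>G\<^esub> g, d) = act (Q (i, c, d)) g) \<and>
        Q ` equivariant_spheres G k I H \<subseteq> A \<and>
        bij_betw Q (topspace (equivariant_discs G k I H) - equivariant_spheres G k I H) (B - A) \<and>
        (\<forall>C\<subseteq>B. closedin (subtopology X B) C \<longleftrightarrow>
           closedin (subtopology X A) (C \<inter> A) \<and>
           closedin (equivariant_discs G k I H)
             {p \<in> topspace (equivariant_discs G k I H). Q p \<in> C}))"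

text \<open>Indices of the filtration are shifted by one: \<open>F 0\<close> is the empty \<open>(-1)\<close>-skeleton and
  \<open>F (Suc k)\<close> is the \<open>k\<close>-skeleton.\<close>

definition G_CW_complex ::
    "('g, 'm) monoid_scheme \<Rightarrow> 'x topology \<Rightarrow> ('x \<Rightarrow> 'g \<Rightarrow> 'x) \<Rightarrow> bool" where
  "G_CW_complex G X act \<longleftrightarrow>
     right_G_space G X act \<and>
     (\<exists>F :: nat \<Rightarrow> 'x set.
        F 0 = {} \<and>
        (\<Union>k. F k) = topspace X \<and>
        (\<forall>k. \<forall>x\<in>F k. \<forall>g\<in>carrier G. act x g \<in> F k) \<and>
        (\<forall>k. attaches_equivariant_cells G X act k (F k) (F (Suc k))) \<and>
        (\<forall>C\<subseteq>topspace X. closedin X C \<longleftrightarrow> (\<forall>k. closedin (subtopology X (F k)) (C \<inter> F k))))"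

definition isotropy_group ::
    "('g, 'm) monoid_scheme \<Rightarrow> ('x \<Rightarrow> 'g \<Rightarrow> 'x) \<Rightarrow> 'x \<Rightarrow> 'g set" where
  "isotropy_group G act x = {g \<in> carrier G. act x g = x}"

definition fixed_point_space ::
    "'x topology \<Rightarrow> ('x \<Rightarrow> 'g \<Rightarrow> 'x) \<Rightarrow> 'g set \<Rightarrow> 'x topology" where
  "fixed_point_space X act Q = subtopology X {x \<in> topspace X. \<forall>q\<in>Q. act x q = x}"

text \<open>The library's \<open>contractible_space\<close> holds for the empty space, which is therefore excluded
  explicitly.\<close>

definition model_for_E_Fin ::
    "('g, 'm) monoid_scheme \<Rightarrow> 'x topology \<Rightarrow> ('x \<Rightarrow> 'g \<Rightarrow> 'x) \<Rightarrow> bool" where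
  "model_for_E_Fin G X act \<longleftrightarrow>
     G_CW_complex G X act \<and>
     (\<forall>x\<in>topspace X. finite (isotropy_group G act x)) \<and>
     (\<forall>Q. subgroup Q G \<and> finite Q \<longrightarrow>
        topspace (fixed_point_space X act Q) \<noteq> {} \<and>
        contractible_space (fixed_point_space X act Q))"

end

theory Submission
  imports Defs
begin

text \<open>Precomposing with shifts only affects how far out on the rays a map starts, so two elements of
  \<open>\<M>\<close> have a join: on each ray shift both as little as possible until they agree.  The injections
  fixed by a finite subgroup \<open>Q\<close> are those with image in the fixed points of \<open>Q\<close>; they form a
  nonempty upward closed subset (elements of \<open>Q\<close> are the identity far out, having finite order),
  hence again a join semilattice, whose realisation contracts along \<open>\<alpha> \<le> \<alpha> \<squnion> \<beta> \<ge> \<beta>\<close> for a fixed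
  \<open>\<beta>\<close>.  Since \<open>H\<^sub>n\<close> preserves the order, an element mapping a finite chain to itself fixes it
  pointwise.  So \<open>|\<M>|\<close> is an equivariant CW-complex with one cell for each orbit of chains, and the
  fixed point set of \<open>Q\<close> is the realisation of the fixed subposet.  An element fixing the vertex
  \<open>\<alpha>\<close> permutes the finite complement of the image of \<open>\<alpha>\<close>, which makes isotropy groups finite.\<close>

section \<open>The weak topology on the realisation\<close>

text \<open>Three obstacles shape the proof. The weak topology is finer than coordinatewise
  convergence, so a map into a realisation is controlled by confining it to finitely many simplices,
  and a homotopy on a realisation can be checked simplex by simplex only thanks to the compactness
  of the interval. For monotone f \<le> g the straight-line homotopy may leave the order complex: if
  u < v, then g u and f v need not be comparable. \<open>sliding_map\<close> moves the mass along
  the chain in order, so that f v and g u occur together only when v \<le> u. Equivariant cells ask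
  for round discs and for indices that are points of the space; hence \<open>disc_to_simplex\<close>
  and the barycentres of orbit representatives. A continuous surjection from the disc that is
  injective on the interior is enough: the quotient topology follows from compactness of the disc.
  That an order-preserving permutation of a finite chain is trivial comes from counting
  down-sets.\<close>

definition support :: "('v \<Rightarrow> real) \<Rightarrow> 'v set" where
  "support f = {v. f v \<noteq> 0}"

lemma geometric_simplexD:
  assumes "f \<in> geometric_simplex \<sigma>"
  shows "0 \<le> f v" "v \<notin> \<sigma> \<Longrightarrow> f v = 0" "sum f \<sigma> = 1" "support f \<subseteq> \<sigma>"
  using assms by (auto simp: geometric_simplex_def support_def)

lemma support_nonempty: "f \<in> geometric_simplex \<sigma> \<Longrightarrow> support f \<noteq> {}"
  by (force simp: geometric_simplex_def support_def)

text \<open>Coordinates outside the support add nothing to the sum. Finiteness guards against the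
  convention that a sum over an infinite set is 0, which makes an infinite "simplex" empty.\<close>

lemma geometric_simplex_iff_support:
  assumes "finite \<sigma>" "support f \<subseteq> \<sigma>"
  shows "f \<in> geometric_simplex \<sigma> \<longleftrightarrow> f \<in> geometric_simplex (support f)"
proof -
  have "sum f \<sigma> = sum f (support f)"
    using assms by (intro sum.mono_neutral_right) (auto simp: support_def)
  then show ?thesis
    using assms by (auto simp: geometric_simplex_def support_def)
qed

lemma in_geometric_simplex_support:
  assumes "finite \<sigma>" "f \<in> geometric_simplex \<sigma>"
  shows "f \<in> geometric_simplex (support f)"
  using assms geometric_simplex_iff_support geometric_simplexD(4) by blast

lemma geometric_simplex_mono:
  assumes "finite \<sigma>" "\<tau> \<subseteq> \<sigma>"
  shows "geometric_simplex \<tau> \<subseteq> geometric_simplex \<sigma>"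
proof
  fix f assume f: "f \<in> geometric_simplex \<tau>"
  have "finite \<tau>" using assms finite_subset by blast
  then show "f \<in> geometric_simplex \<sigma>"
    using f assms geometric_simplexD(4)[OF f] geometric_simplex_iff_support
    by (metis order_trans)
qed

lemma closed_geometric_simplex: "closed (geometric_simplex \<sigma>)"
proof -
  have c: "continuous_on UNIV (\<lambda>f::'a \<Rightarrow> real. f v)" for v
    by (rule continuous_on_product_coordinates)
  have "continuous_on UNIV (\<lambda>f::'a \<Rightarrow> real. \<Sum>v\<in>\<sigma>. f v)"
    by (intro continuous_on_sum c)
  then show ?thesis
    unfolding geometric_simplex_def imp_conv_disj
    by (intro closed_Collect_conj closed_Collect_all closed_Collect_disj closed_Collect_le
        closed_Collect_eq closed_Collect_const continuous_on_const c)
qed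

lemma topspace_geometric_realisation [simp]:
  "topspace (geometric_realisation K) = \<Union> (geometric_simplex ` K)"
proof
  show "topspace (geometric_realisation K) \<subseteq> \<Union> (geometric_simplex ` K)"
    using openin_geometric_realisation openin_topspace by blast
  have "(\<Union> (geometric_simplex ` K)) \<inter> geometric_simplex \<sigma> = geometric_simplex \<sigma>" if "\<sigma> \<in> K" for \<sigma>
    using that by blast
  then have "openin (geometric_realisation K) (\<Union> (geometric_simplex ` K))"
    by (simp add: openin_geometric_realisation)
  then show "\<Union> (geometric_simplex ` K) \<subseteq> topspace (geometric_realisation K)"
    by (rule openin_subset)
qed

text \<open>Simplices are closed in the product topology, so relative closedness in a simplex turns
  into plain \<open>closed\<close>. This makes closed sets the convenient ones for skeleta and
  cells.\<close>

lemma closedin_geometric_realisation: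
  "closedin (geometric_realisation K) C \<longleftrightarrow>
     C \<subseteq> \<Union> (geometric_simplex ` K) \<and> (\<forall>\<sigma>\<in>K. closed (C \<inter> geometric_simplex \<sigma>))"
proof -
  have "openin (top_of_set (geometric_simplex \<sigma>))
            ((\<Union> (geometric_simplex ` K) - C) \<inter> geometric_simplex \<sigma>)
        \<longleftrightarrow> closed (C \<inter> geometric_simplex \<sigma>)" if "\<sigma> \<in> K" for \<sigma>
  proof -
    have "(\<Union> (geometric_simplex ` K) - C) \<inter> geometric_simplex \<sigma>
            = geometric_simplex \<sigma> - (C \<inter> geometric_simplex \<sigma>)"
      using that by blast
    then show ?thesis
      using closedin_closed_eq[OF closed_geometric_simplex[of \<sigma>], of "C \<inter> geometric_simplex \<sigma>"]
      by (simp add: closedin_def Int_Diff)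
  qed
  then show ?thesis
    by (auto simp: closedin_def openin_geometric_realisation)
qed

text \<open>The universal property of the weak topology.\<close>

lemma continuous_map_from_realisation:
  assumes "\<And>\<sigma>. \<sigma> \<in> K \<Longrightarrow> continuous_map (top_of_set (geometric_simplex \<sigma>)) Y h"
  shows "continuous_map (geometric_realisation K) Y h"
  unfolding continuous_map_def
proof (intro conjI allI impI)
  show "h \<in> topspace (geometric_realisation K) \<rightarrow> topspace Y"
    using assms by (fastforce simp: continuous_map_def)
  fix U assume U: "openin Y U"
  have "openin (top_of_set (geometric_simplex \<sigma>))
      ({x \<in> topspace (geometric_realisation K). h x \<in> U} \<inter> geometric_simplex \<sigma>)" if "\<sigma> \<in> K" for \<sigma>
  proof -
    have "{x \<in> topspace (geometric_realisation K). h x \<in> U} \<inter> geometric_simplex \<sigma>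
        = {x \<in> geometric_simplex \<sigma>. h x \<in> U}"
      using that by auto
    then show ?thesis
      using openin_continuous_map_preimage[OF assms[OF that] U] by simp
  qed
  then show "openin (geometric_realisation K) {x \<in> topspace (geometric_realisation K). h x \<in> U}"
    by (auto simp: openin_geometric_realisation)
qed

text \<open>Coordinatewise continuity alone does not suffice for the weak topology. If finitely many
  simplices contain the image, the preimage of a closed set is a finite union of closed sets, one
  for each of them.\<close>

lemma continuous_map_into_realisation:
  assumes "finite T" "T \<subseteq> K" and h: "continuous_map Z euclidean h"
    and into: "h ` topspace Z \<subseteq> \<Union> (geometric_simplex ` T)"
  shows "continuous_map Z (geometric_realisation K) h"
  unfolding continuous_map_closedin
proof (intro conjI ballI allI impI)
  have "\<Union> (geometric_simplex ` T) \<subseteq> topspace (geometric_realisation K)"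
    using \<open>T \<subseteq> K\<close> by auto
  then show "h \<in> topspace Z \<rightarrow> topspace (geometric_realisation K)"
    using into by blast
  fix C assume C: "closedin (geometric_realisation K) C"
  have "{x \<in> topspace Z. h x \<in> C} = (\<Union>\<tau>\<in>T. {x \<in> topspace Z. h x \<in> C \<inter> geometric_simplex \<tau>})"
    using into by auto
  moreover have "closedin Z {x \<in> topspace Z. h x \<in> C \<inter> geometric_simplex \<tau>}" if "\<tau> \<in> T" for \<tau>
  proof (rule closedin_continuous_map_preimage[OF h])
    show "closedin euclidean (C \<inter> geometric_simplex \<tau>)"
      using C that \<open>T \<subseteq> K\<close> by (auto simp: closedin_geometric_realisation)
  qed
  ultimately show "closedin Z {x \<in> topspace Z. h x \<in> C}"
    using \<open>finite T\<close> by (metis (no_types, lifting) closedin_Union finite_imageI imageE)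
qed

lemma continuous_map_fun_componentwise:
  fixes h :: "'z \<Rightarrow> 'v \<Rightarrow> real"
  shows "continuous_map Z euclidean h \<longleftrightarrow> (\<forall>v. continuous_map Z euclideanreal (\<lambda>z. h z v))"
  by (metis continuous_map_componentwise_UNIV euclidean_product_topology)

text \<open>A simplex \<sigma> of K meets |L| only in those of its faces that belong to L: the
  support of a common point lies in \<sigma> and, as L is closed under faces, in L. There are
  finitely many such faces, so closedness tested on L gives closedness on \<sigma>.\<close>

lemma
  assumes fin: "\<And>\<sigma>. \<sigma> \<in> K \<Longrightarrow> finite \<sigma>" and "L \<subseteq> K"
    and faces: "\<And>\<sigma> \<tau>. \<lbrakk>\<sigma> \<in> L; \<tau> \<subseteq> \<sigma>; \<tau> \<noteq> {}\<rbrakk> \<Longrightarrow> \<tau> \<in> L"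
  shows closedin_subcomplex: "closedin (geometric_realisation K) (\<Union> (geometric_simplex ` L))"
    and subtopology_subcomplex:
      "subtopology (geometric_realisation K) (\<Union> (geometric_simplex ` L)) = geometric_realisation L"
proof -
  have closed: "closed (C \<inter> geometric_simplex \<sigma>)"
    if C: "C \<subseteq> \<Union> (geometric_simplex ` L)" "\<forall>\<tau>\<in>L. closed (C \<inter> geometric_simplex \<tau>)" and "\<sigma> \<in> K" for C \<sigma>
  proof -
    have "C \<inter> geometric_simplex \<sigma> = (\<Union>\<tau>\<in>{\<tau>\<in>L. \<tau> \<subseteq> \<sigma>}. C \<inter> geometric_simplex \<tau>)"
    proof (intro equalityI subsetI)
      fix f assume f: "f \<in> C \<inter> geometric_simplex \<sigma>"
      then obtain \<tau> where \<tau>: "\<tau> \<in> L" "f \<in> geometric_simplex \<tau>"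
        using C by blast
      have "support f \<in> L"
        using faces[OF \<tau>(1)] \<tau> geometric_simplexD(4) support_nonempty by metis
      moreover have "support f \<subseteq> \<sigma>" "f \<in> geometric_simplex (support f)"
        using f fin[OF \<open>\<sigma> \<in> K\<close>] geometric_simplexD(4) in_geometric_simplex_support by auto
      ultimately show "f \<in> (\<Union>\<tau>\<in>{\<tau>\<in>L. \<tau> \<subseteq> \<sigma>}. C \<inter> geometric_simplex \<tau>)"
        using f by blast
    qed (use geometric_simplex_mono fin[OF \<open>\<sigma> \<in> K\<close>] in blast)
    moreover have "finite {\<tau>\<in>L. \<tau> \<subseteq> \<sigma>}"
      using fin[OF \<open>\<sigma> \<in> K\<close>] by simp
    ultimately show ?thesis
      using C by (metis (no_types, lifting) closed_UN mem_Collect_eq)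
  qed
  have cl: "closedin (geometric_realisation K) C \<longleftrightarrow> closedin (geometric_realisation L) C"
    if "C \<subseteq> \<Union> (geometric_simplex ` L)" for C
    using that closed \<open>L \<subseteq> K\<close> unfolding closedin_geometric_realisation by blast
  show *: "closedin (geometric_realisation K) (\<Union> (geometric_simplex ` L))"
    using cl closedin_topspace topspace_geometric_realisation by (metis subset_refl)
  have t: "topspace (subtopology (geometric_realisation K) (\<Union> (geometric_simplex ` L))) = \<Union> (geometric_simplex ` L)"
    using \<open>L \<subseteq> K\<close> by auto
  have "closedin (subtopology (geometric_realisation K) (\<Union> (geometric_simplex ` L))) C
      \<longleftrightarrow> closedin (geometric_realisation L) C" for C
    using cl closedin_closed_subtopology[OF *] closedin_subset topspace_geometric_realisation by metis
  then show "subtopology (geometric_realisation K) (\<Union> (geometric_simplex ` L)) = geometric_realisation L"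
    unfolding topology_eq openin_closedin_eq t by simp
qed

section \<open>Affine extensions of vertex maps\<close>

lemma affine_extension_eq_sum:
  assumes "finite \<sigma>" "support f \<subseteq> \<sigma>"
  shows "affine_extension \<phi> f w = (\<Sum>v | v \<in> \<sigma> \<and> \<phi> v = w. f v)"
  unfolding affine_extension_def
  using assms by (intro sum.mono_neutral_left) (auto simp: support_def)

lemma affine_extension_in_simplex:
  assumes "finite \<sigma>" and f: "f \<in> geometric_simplex \<sigma>"
  shows "affine_extension \<phi> f \<in> geometric_simplex (\<phi> ` \<sigma>)"
proof -
  note ae = affine_extension_eq_sum[OF \<open>finite \<sigma>\<close> geometric_simplexD(4)[OF f], of \<phi>]
  have "(\<Sum>w\<in>\<phi> ` \<sigma>. affine_extension \<phi> f w) = sum f \<sigma>"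
    unfolding ae using sum.image_gen[OF \<open>finite \<sigma>\<close>, of f \<phi>] by simp
  moreover have "affine_extension \<phi> f w = 0" if "w \<notin> \<phi> ` \<sigma>" for w
    unfolding ae using that by (intro sum.neutral) auto
  moreover have "0 \<le> affine_extension \<phi> f w" for w
    unfolding ae using geometric_simplexD(1)[OF f] by (intro sum_nonneg) auto
  ultimately show ?thesis
    using geometric_simplexD(3)[OF f] by (auto simp: geometric_simplex_def)
qed

lemma continuous_map_affine_extension:
  assumes fin: "\<And>\<sigma>. \<sigma> \<in> K \<Longrightarrow> finite \<sigma>" and maps: "\<And>\<sigma>. \<sigma> \<in> K \<Longrightarrow> \<phi> ` \<sigma> \<in> L"
  shows "continuous_map (geometric_realisation K) (geometric_realisation L) (affine_extension \<phi>)"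
proof (rule continuous_map_from_realisation)
  fix \<sigma> assume "\<sigma> \<in> K"
  let ?D = "geometric_simplex \<sigma>"
  have "continuous_on ?D (\<lambda>f. affine_extension \<phi> f w)" for w
  proof -
    \<comment> \<open>The index set in the definition varies with f; on a fixed simplex it is
      replaced by a constant finite one, and continuity becomes that of a finite sum of
      coordinates.\<close>
    have "continuous_on ?D (\<lambda>f. \<Sum>v | v \<in> \<sigma> \<and> \<phi> v = w. f v)"
      by (intro continuous_on_sum continuous_on_subset[OF continuous_on_product_coordinates]) simp
    then show ?thesis
      by (rule continuous_on_eq)
        (rule affine_extension_eq_sum[OF fin[OF \<open>\<sigma> \<in> K\<close>] geometric_simplexD(4), symmetric])
  qed
  then have "continuous_map (top_of_set ?D) euclidean (affine_extension \<phi>)"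
    by (simp add: continuous_map_fun_componentwise)
  then show "continuous_map (top_of_set ?D) (geometric_realisation L) (affine_extension \<phi>)"
    using affine_extension_in_simplex[OF fin[OF \<open>\<sigma> \<in> K\<close>]] maps[OF \<open>\<sigma> \<in> K\<close>]
    by (intro continuous_map_into_realisation[where T="{\<phi> ` \<sigma>}"]) auto
qed

lemma
  assumes "finite \<sigma>" "f \<in> geometric_simplex \<sigma>" and inj: "inj_on \<phi> \<sigma>"
  shows affine_extension_inj: "v \<in> \<sigma> \<Longrightarrow> affine_extension \<phi> f (\<phi> v) = f v"
    and support_affine_extension_inj: "support (affine_extension \<phi> f) = \<phi> ` support f"
proof -
  note ae = affine_extension_eq_sum[OF \<open>finite \<sigma>\<close> geometric_simplexD(4)[OF assms(2)], of \<phi>]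
  show *: "affine_extension \<phi> f (\<phi> v) = f v" if "v \<in> \<sigma>" for v
  proof -
    have "{u. u \<in> \<sigma> \<and> \<phi> u = \<phi> v} = {v}" using that inj by (auto dest: inj_onD)
    then show ?thesis unfolding ae by simp
  qed
  have "affine_extension \<phi> f w = 0" if "w \<notin> \<phi> ` \<sigma>" for w
    unfolding ae using that by (intro sum.neutral) auto
  then have "support (affine_extension \<phi> f) \<subseteq> \<phi> ` \<sigma>"
    by (auto simp: support_def)
  then show "support (affine_extension \<phi> f) = \<phi> ` support f"
    using * geometric_simplexD(4)[OF assms(2)] unfolding support_def by fastforce
qed

lemma affine_extension_cong:
  assumes "\<And>v. v \<in> support f \<Longrightarrow> \<phi> v = \<psi> v"
  shows "affine_extension \<phi> f = affine_extension \<psi> f"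
  using assms unfolding affine_extension_def support_def by (intro ext sum.cong) auto

lemma affine_extension_id: "affine_extension (\<lambda>v. v) f = f"
proof
  fix w
  have "{v. f v \<noteq> 0 \<and> v = w} = (if f w = 0 then {} else {w})" by auto
  then show "affine_extension (\<lambda>v. v) f w = f w" by (simp add: affine_extension_def)
qed

lemma affine_extension_comp:
  assumes "finite \<sigma>" and f: "f \<in> geometric_simplex \<sigma>"
  shows "affine_extension \<psi> (affine_extension \<phi> f) = affine_extension (\<lambda>v. \<psi> (\<phi> v)) f"
proof
  fix w
  note supp = geometric_simplexD(4)[OF f]
  have supp': "support (affine_extension \<phi> f) \<subseteq> \<phi> ` \<sigma>"
    by (rule geometric_simplexD(4)[OF affine_extension_in_simplex[OF assms]])
  let ?A = "{v \<in> \<sigma>. \<psi> (\<phi> v) = w}" and ?B = "{u \<in> \<phi> ` \<sigma>. \<psi> u = w}"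
  have "affine_extension \<psi> (affine_extension \<phi> f) w = (\<Sum>u\<in>?B. affine_extension \<phi> f u)"
    by (rule affine_extension_eq_sum[OF finite_imageI[OF \<open>finite \<sigma>\<close>] supp'])
  also have "\<dots> = (\<Sum>u\<in>?B. \<Sum>v | v \<in> ?A \<and> \<phi> v = u. f v)"
  proof (rule sum.cong[OF refl])
    fix u assume "u \<in> ?B"
    then have "{v. v \<in> \<sigma> \<and> \<phi> v = u} = {v. v \<in> ?A \<and> \<phi> v = u}" by auto
    then show "affine_extension \<phi> f u = (\<Sum>v | v \<in> ?A \<and> \<phi> v = u. f v)"
      using affine_extension_eq_sum[OF \<open>finite \<sigma>\<close> supp, of \<phi> u] by (simp only:)
  qed
  also have "\<dots> = sum f ?A"
    by (rule sum.group) (use \<open>finite \<sigma>\<close> in auto)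
  also have "\<dots> = affine_extension (\<lambda>v. \<psi> (\<phi> v)) f w"
    by (rule affine_extension_eq_sum[OF \<open>finite \<sigma>\<close> supp, symmetric])
  finally show "affine_extension \<psi> (affine_extension \<phi> f) w = affine_extension (\<lambda>v. \<psi> (\<phi> v)) f w" .
qed

section \<open>From the disc to the simplex\<close>

definition disc :: "nat \<Rightarrow> (nat \<Rightarrow> real) set" where
  "disc k = {d. (\<forall>i\<ge>k. d i = 0) \<and> L2_set d {..<k} \<le> 1}"

lemma unit_disc_eq: "unit_disc k = top_of_set (disc k)"
proof -
  have "{x. \<forall>i\<ge>k. x i = 0} \<inter> {x. (\<Sum>i<k. x i ^ 2) \<le> 1} = disc k"
    by (auto simp: disc_def L2_set_def)
  then show ?thesis
    by (simp add: unit_disc_def Euclidean_space_def euclidean_product_topology subtopology_subtopology)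
qed

lemma disc_boundary_eq: "disc_boundary k = {d \<in> disc k. L2_set d {..<k} = 1}"
  by (simp add: disc_boundary_def unit_disc_eq L2_set_def)

lemma disc_interior: "\<lbrakk>d \<in> disc k; d \<notin> disc_boundary k\<rbrakk> \<Longrightarrow> L2_set d {..<k} < 1"
  by (simp add: disc_boundary_eq disc_def less_le)

lemma continuous_on_coordinate: "continuous_on S (\<lambda>d::'v \<Rightarrow> real. d i)"
  by (rule continuous_on_subset[OF continuous_on_product_coordinates]) simp

lemma continuous_on_L2_set: "continuous_on S (\<lambda>d. L2_set d {..<k::nat})"
  unfolding L2_set_def by (intro continuous_intros continuous_on_coordinate)

lemma closed_disc: "closed (disc k)"
  unfolding disc_def imp_conv_disj
  by (intro closed_Collect_conj closed_Collect_all closed_Collect_disj closed_Collect_le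
      closed_Collect_eq closed_Collect_const continuous_on_const continuous_on_coordinate
      continuous_on_L2_set)

text \<open>The disc sits in an infinite product, so compactness is inherited from the cube of all
  sequences in [-1, 1], compact by Tychonoff, in which the disc is closed.\<close>

lemma compact_disc: "compact (disc k)"
proof -
  have "compactin (product_topology (\<lambda>i::nat. euclideanreal) UNIV) (PiE UNIV (\<lambda>i. {-1..1}))"
    by (subst compactin_PiE) auto
  then have "compact (PiE UNIV (\<lambda>i::nat. {-1..1::real}))"
    by (simp add: euclidean_product_topology)
  moreover have "disc k \<subseteq> PiE UNIV (\<lambda>i. {-1..1})"
  proof
    fix d assume d: "d \<in> disc k"
    have abs: "\<bar>d i\<bar> \<le> 1" for i
    proof (cases "i < k")
      case True
      then have "\<bar>d i\<bar> \<le> L2_set (\<lambda>i. \<bar>d i\<bar>) {..<k}" by (intro member_le_L2_set) auto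
      moreover have "L2_set (\<lambda>i. \<bar>d i\<bar>) {..<k} = L2_set d {..<k}" by (simp add: L2_set_def)
      ultimately show ?thesis using d by (simp add: disc_def)
    qed (use d in \<open>auto simp: disc_def\<close>)
    have "-1 \<le> d i \<and> d i \<le> 1" for i using abs[of i] by arith
    then show "d \<in> PiE UNIV (\<lambda>i. {-1..1})" by (simp add: PiE_UNIV_domain)
  qed
  ultimately show ?thesis
    using closed_disc by (metis compact_Int_closed inf.absorb_iff2)
qed

lemma continuous_on_Min_atMost:
  "continuous_on S (\<lambda>d::nat \<Rightarrow> real. Min (d ` {..k}))"
proof (induction k)
  case 0
  then show ?case by (simp add: continuous_on_coordinate)
next
  case (Suc k)
  have "Min (d ` {..Suc k}) = min (d (Suc k)) (Min (d ` {..k}))" for d :: "nat \<Rightarrow> real"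
    by (simp add: atMost_Suc)
  then show ?case by (simp add: continuous_on_min continuous_on_coordinate Suc)
qed

text \<open>A map from the disc onto the standard simplex, injective on the interior.  With \<open>d k = 0\<close>, the
  numbers \<open>d j - m\<close>, where \<open>m = Min (d ` {..k})\<close>, determine \<open>d\<close> and are the barycentric coordinates,
  up to scale, of a point in the boundary of the simplex; adding \<open>1 - \<bar>d\<bar>\<close> to all of them moves this
  point towards the barycentre.\<close>

definition simplex_weight :: "nat \<Rightarrow> (nat \<Rightarrow> real) \<Rightarrow> nat \<Rightarrow> real" where
  "simplex_weight k d j = 1 - L2_set d {..<k} + (d j - Min (d ` {..k}))"

definition disc_to_simplex :: "nat \<Rightarrow> (nat \<Rightarrow> real) \<Rightarrow> nat \<Rightarrow> real" where
  "disc_to_simplex k d j =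
     (if j \<le> k then simplex_weight k d j / (\<Sum>i\<le>k. simplex_weight k d i) else 0)"

lemma simplex_weight_ge:
  assumes "j \<le> k" shows "1 - L2_set d {..<k} \<le> simplex_weight k d j"
  using assms by (simp add: simplex_weight_def Min_le)

text \<open>Together with \<open>simplex_weight_ge\<close>: the least weight is exactly 1 - |d|.
  Thus |d| can be read off the weights, and on the disc some weight vanishes precisely at the
  boundary.\<close>

lemma simplex_weight_attained:
  obtains j where "j \<le> k" "simplex_weight k d j = 1 - L2_set d {..<k}"
proof -
  have "Min (d ` {..k}) \<in> d ` {..k}" by (intro Min_in) auto
  then obtain j where "Min (d ` {..k}) = d j" "j \<in> {..k}" by (rule imageE)
  then show ?thesis using that[of j] by (simp add: simplex_weight_def)
qed

lemma simplex_weight_diff: "simplex_weight k d i - simplex_weight k d j = d i - d j"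
  by (simp add: simplex_weight_def)

text \<open>If all weights were 0, all d j would equal d k = 0; but for d = 0 the least weight is
  1.\<close>

lemma sum_simplex_weight_pos:
  assumes d: "d \<in> disc k" shows "0 < (\<Sum>i\<le>k. simplex_weight k d i)"
proof -
  have nonneg: "0 \<le> simplex_weight k d i" if "i \<le> k" for i
    using simplex_weight_ge[OF that, of d] d by (simp add: disc_def)
  have "\<exists>i\<le>k. simplex_weight k d i \<noteq> 0"
  proof (rule ccontr)
    assume "\<not> ?thesis"
    then have w: "simplex_weight k d i = 0" if "i \<le> k" for i using that by blast
    have "d i = 0" if "i < k" for i
      using w[of i] w[of k] that d simplex_weight_diff[of k d i k] by (simp add: disc_def)
    then have "L2_set d {..<k} = 0" by (simp add: L2_set_def)
    moreover obtain j where "j \<le> k" "simplex_weight k d j = 1 - L2_set d {..<k}"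
      by (rule simplex_weight_attained)
    ultimately show False using w[of j] by simp
  qed
  then obtain i where "i \<le> k" "simplex_weight k d i \<noteq> 0" by blast
  then show ?thesis
    using nonneg by (intro sum_pos2[of _ i]) (auto simp: less_le)
qed

lemma disc_to_simplex_in_simplex:
  assumes d: "d \<in> disc k" shows "disc_to_simplex k d \<in> geometric_simplex {..k}"
proof -
  let ?S = "\<Sum>i\<le>k. simplex_weight k d i"
  have "0 \<le> simplex_weight k d i" if "i \<le> k" for i
    using simplex_weight_ge[OF that, of d] d by (simp add: disc_def)
  moreover have "(\<Sum>j\<le>k. disc_to_simplex k d j) = ?S / ?S"
    by (simp add: disc_to_simplex_def flip: sum_divide_distrib)
  ultimately show ?thesis
    using sum_simplex_weight_pos[OF d] by (simp add: geometric_simplex_def disc_to_simplex_def)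
qed

lemma support_disc_to_simplex:
  assumes d: "d \<in> disc k"
  shows "support (disc_to_simplex k d) = {..k} \<longleftrightarrow> d \<notin> disc_boundary k"
proof -
  note S = sum_simplex_weight_pos[OF d]
  have eq: "support (disc_to_simplex k d) = {..k} \<longleftrightarrow> (\<forall>j\<le>k. simplex_weight k d j \<noteq> 0)"
    using S by (auto simp: support_def disc_to_simplex_def set_eq_iff)
  show ?thesis
  proof (cases "d \<in> disc_boundary k")
    case True
    obtain j where "j \<le> k" "simplex_weight k d j = 1 - L2_set d {..<k}"
      by (rule simplex_weight_attained)
    then show ?thesis using True eq by (auto simp: disc_boundary_eq)
  next
    case False
    then have "L2_set d {..<k} < 1" using d disc_interior by blast
    then have "\<forall>j\<le>k. simplex_weight k d j \<noteq> 0"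
      using simplex_weight_ge[of _ k d] by force
    then show ?thesis using False eq by blast
  qed
qed

text \<open>Equal images mean weights proportional by a factor c. Comparing least weights gives 1 -
  |d| = c (1 - |d'|); comparing differences with the k-th weight gives d = c d', hence |d| = c |d'|.
  Adding the two norm equations yields c = 1.\<close>

lemma disc_to_simplex_inj:
  assumes d: "d \<in> disc k - disc_boundary k" and d': "d' \<in> disc k - disc_boundary k"
    and eq: "disc_to_simplex k d = disc_to_simplex k d'"
  shows "d = d'"
proof -
  define c where "c = (\<Sum>i\<le>k. simplex_weight k d i) / (\<Sum>i\<le>k. simplex_weight k d' i)"
  have pos: "0 < (\<Sum>i\<le>k. simplex_weight k d i)" "0 < (\<Sum>i\<le>k. simplex_weight k d' i)"
    using d d' sum_simplex_weight_pos by auto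
  then have "c > 0" by (simp add: c_def)
  have w: "simplex_weight k d j = c * simplex_weight k d' j" if "j \<le> k" for j
    using fun_cong[OF eq, of j] that pos by (simp add: disc_to_simplex_def c_def field_simps)
  have N': "L2_set d' {..<k} < 1" using d' disc_interior by blast
  obtain j where j: "j \<le> k" "simplex_weight k d j = 1 - L2_set d {..<k}"
    by (rule simplex_weight_attained)
  obtain j' where j': "j' \<le> k" "simplex_weight k d' j' = 1 - L2_set d' {..<k}"
    by (rule simplex_weight_attained)
  have "c * (1 - L2_set d' {..<k}) \<le> c * simplex_weight k d' j"
    using simplex_weight_ge[OF j(1), of d'] \<open>c > 0\<close> by simp
  then have N: "1 - L2_set d {..<k} = c * (1 - L2_set d' {..<k})"
    using simplex_weight_ge[OF j'(1), of d] w[OF j(1)] w[OF j'(1)] j(2) j'(2) by simp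
  have cd: "d j = c * d' j" for j
  proof (cases "j < k")
    case True
    have dj: "d j = simplex_weight k d j - simplex_weight k d k"
      and d'j: "d' j = simplex_weight k d' j - simplex_weight k d' k"
      using d d' by (simp_all add: simplex_weight_diff disc_def)
    show ?thesis
      unfolding d'j right_diff_distrib using dj w[of j] w[of k] True by simp
  qed (use d d' in \<open>auto simp: disc_def\<close>)
  then have "L2_set d {..<k} = L2_set (\<lambda>j. c * d' j) {..<k}"
    by (intro L2_set_cong) auto
  then have "L2_set d {..<k} = c * L2_set d' {..<k}"
    using \<open>c > 0\<close> by (simp add: L2_set_right_distrib)
  then have "c = 1" using N by (simp add: algebra_simps)
  then show ?thesis using cd by auto
qed

lemma disc_to_simplex_surj:
  assumes f: "f \<in> geometric_simplex {..k}"
  shows "\<exists>d\<in>disc k. disc_to_simplex k d = f"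
proof -
  define \<mu> where "\<mu> = Min (f ` {..k})"
  \<comment> \<open>Weight differences are differences of d and d k = 0, so d must be a multiple e /
    s of the differences of f. The weights should be f / s; for the least one this reads 1 - |e| / s
    = \<mu> / s, which forces the value of s.\<close>
  define e where "e j = (if j < k then f j - f k else 0)" for j
  define s where "s = \<mu> + L2_set e {..<k}"
  define d where "d j = e j / s" for j
  have "\<mu> \<in> f ` {..k}" unfolding \<mu>_def by (intro Min_in) auto
  then have "\<mu> \<ge> 0" using geometric_simplexD(1)[OF f] by auto
  have "s > 0"
  proof (rule ccontr)
    \<comment> \<open>Then f is constant on the vertices with minimum 0, contradicting total mass
      1.\<close>
    assume "\<not> s > 0"
    then have "\<mu> = 0" "L2_set e {..<k} = 0"
      using \<open>\<mu> \<ge> 0\<close> L2_set_nonneg[of e "{..<k}"] unfolding s_def by linarith+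
    then have "\<forall>j<k. f j = f k"
      by (auto simp: L2_set_eq_0_iff e_def)
    then have fk: "\<forall>j\<le>k. f j = f k" by (metis le_neq_implies_less)
    obtain j where "j \<le> k" "\<mu> = f j" using \<open>\<mu> \<in> f ` {..k}\<close> by blast
    then have "f k = 0" using fk \<open>\<mu> = 0\<close> by metis
    then have "\<forall>j\<le>k. f j = 0" using fk by metis
    then have "sum f {..k} = 0" by simp
    then show False using geometric_simplexD(3)[OF f] by simp
  qed
  have e: "e j = f j - f k" if "j \<le> k" for j
    using that unfolding e_def by (cases "j = k") simp_all
  have "L2_set d {..<k} = L2_set (\<lambda>j. inverse s * e j) {..<k}"
    by (rule L2_set_cong) (simp_all add: d_def divide_inverse_commute)
  also have "\<dots> = inverse s * L2_set e {..<k}"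
    by (rule L2_set_right_distrib[symmetric]) (use \<open>s > 0\<close> in simp)
  finally have Nd: "L2_set d {..<k} = L2_set e {..<k} / s"
    by (simp add: divide_inverse_commute)
  then have "L2_set d {..<k} \<le> 1" using \<open>s > 0\<close> \<open>\<mu> \<ge> 0\<close> by (simp add: s_def)
  then have "d \<in> disc k" by (simp add: disc_def d_def e_def)
  have "Min (d ` {..k}) = (\<mu> - f k) / s"
  proof (rule Min_eqI)
    show "(\<mu> - f k) / s \<in> d ` {..k}" using \<open>\<mu> \<in> f ` {..k}\<close> e by (auto simp: d_def)
    show "(\<mu> - f k) / s \<le> y" if "y \<in> d ` {..k}" for y
    proof -
      from that obtain j where j: "j \<le> k" "y = d j" by auto
      have "\<mu> \<le> f j" unfolding \<mu>_def using j by (intro Min_le) auto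
      then show ?thesis using j e \<open>s > 0\<close> by (simp add: d_def divide_right_mono)
    qed
  qed simp
  then have w: "simplex_weight k d j = f j / s" if "j \<le> k" for j
    using e[OF that] \<open>s > 0\<close> Nd by (simp add: simplex_weight_def d_def s_def field_simps)
  then have "(\<Sum>i\<le>k. simplex_weight k d i) = 1 / s"
    using geometric_simplexD(3)[OF f] by (simp flip: sum_divide_distrib)
  then have "disc_to_simplex k d = f"
    using w \<open>s > 0\<close> geometric_simplexD(2)[OF f] by (auto simp: disc_to_simplex_def fun_eq_iff)
  then show ?thesis using \<open>d \<in> disc k\<close> by blast
qed

lemma continuous_on_disc_to_simplex: "continuous_on (disc k) (\<lambda>d. disc_to_simplex k d j)"
proof (cases "j \<le> k")
  case True
  have w: "continuous_on (disc k) (\<lambda>d. simplex_weight k d j)" for j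
    unfolding simplex_weight_def
    by (intro continuous_intros continuous_on_coordinate continuous_on_L2_set continuous_on_Min_atMost)
  have "\<forall>d\<in>disc k. (\<Sum>i\<le>k. simplex_weight k d i) \<noteq> 0"
    using sum_simplex_weight_pos by force
  then show ?thesis
    using True by (simp add: disc_to_simplex_def) (intro continuous_intros w)
next
  case False
  then show ?thesis by (simp add: disc_to_simplex_def)
qed

lemma compact_imp_closed_fun:
  fixes C :: "('v \<Rightarrow> real) set"
  assumes "compact C" shows "closed C"
proof -
  have "Hausdorff_space (euclidean :: ('v \<Rightarrow> real) topology)"
    by (simp flip: euclidean_product_topology add: Hausdorff_space_product_topology)
  then show ?thesis
    using compactin_imp_closedin[of euclidean C] assms by simp
qed

section \<open>Regular actions on simplicial complexes\<close>

lemma support_mem_subcomplex: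
  assumes fin: "\<And>\<sigma>. \<sigma> \<in> K \<Longrightarrow> finite \<sigma>"
    and faces: "\<And>\<sigma> \<tau>. \<lbrakk>\<sigma> \<in> K; \<tau> \<subseteq> \<sigma>; \<tau> \<noteq> {}\<rbrakk> \<Longrightarrow> \<tau> \<in> K"
    and x: "x \<in> topspace (geometric_realisation K)"
  shows "support x \<in> K" "x \<in> geometric_simplex (support x)"
proof -
  from x obtain \<sigma> where \<sigma>: "\<sigma> \<in> K" "x \<in> geometric_simplex \<sigma>" by auto
  show "support x \<in> K"
    by (rule faces[OF \<sigma>(1) geometric_simplexD(4)[OF \<sigma>(2)] support_nonempty[OF \<sigma>(2)]])
  show "x \<in> geometric_simplex (support x)"
    by (rule in_geometric_simplex_support[OF fin[OF \<sigma>(1)] \<sigma>(2)])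
qed

section \<open>Closed sets in the space of equivariant discs\<close>

lemma closedin_prod_discrete:
  "closedin (prod_topology (discrete_topology S) Y) P \<longleftrightarrow>
     P \<subseteq> S \<times> topspace Y \<and> (\<forall>c\<in>S. closedin Y {d. (c, d) \<in> P})"
proof
  assume P: "closedin (prod_topology (discrete_topology S) Y) P"
  have "closedin Y {d. (c, d) \<in> P}" if "c \<in> S" for c
  proof -
    have "continuous_map Y (prod_topology (discrete_topology S) Y) (\<lambda>d. (c, d))"
      using that by (intro continuous_map_pairedI) auto
    from closedin_continuous_map_preimage[OF this P]
    have "closedin Y {d \<in> topspace Y. (c, d) \<in> P}" .
    moreover have "{d \<in> topspace Y. (c, d) \<in> P} = {d. (c, d) \<in> P}"
      using closedin_subset[OF P] by auto
    ultimately show ?thesis by simp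
  qed
  then show "P \<subseteq> S \<times> topspace Y \<and> (\<forall>c\<in>S. closedin Y {d. (c, d) \<in> P})"
    using closedin_subset[OF P] by auto
next
  assume P: "P \<subseteq> S \<times> topspace Y \<and> (\<forall>c\<in>S. closedin Y {d. (c, d) \<in> P})"
  have "openin (prod_topology (discrete_topology S) Y) (S \<times> topspace Y - P)"
    unfolding openin_prod_topology_alt
  proof (intro allI impI)
    fix c d assume cd: "(c, d) \<in> S \<times> topspace Y - P"
    then have "openin Y (topspace Y - {d. (c, d) \<in> P})" using P by (auto simp: closedin_def)
    moreover have "{c} \<times> (topspace Y - {d. (c, d) \<in> P}) \<subseteq> S \<times> topspace Y - P"
      using cd by auto
    ultimately show "\<exists>U V. openin (discrete_topology S) U \<and> openin Y V \<and> c \<in> U \<and> d \<in> V \<and>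
        U \<times> V \<subseteq> S \<times> topspace Y - P"
      using cd by (intro exI[of _ "{c}"] exI[of _ "topspace Y - {d. (c, d) \<in> P}"]) auto
  qed
  then show "closedin (prod_topology (discrete_topology S) Y) P"
    using P by (simp add: closedin_def)
qed

lemma topspace_equivariant_discs:
  "topspace (equivariant_discs G k I H) = (SIGMA i:I. (rcosets\<^bsub>G\<^esub> (H i)) \<times> disc k)"
  by (auto simp: equivariant_discs_def unit_disc_eq)

lemma closedin_equivariant_discs:
  "closedin (equivariant_discs G k I H) P \<longleftrightarrow>
     P \<subseteq> topspace (equivariant_discs G k I H) \<and>
     (\<forall>i\<in>I. \<forall>c\<in>rcosets\<^bsub>G\<^esub> (H i). closed {d. (i, c, d) \<in> P})"
proof -
  have "closedin (top_of_set (disc k)) {d. (i, c, d) \<in> P} \<longleftrightarrow> closed {d. (i, c, d) \<in> P}"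
    if "P \<subseteq> topspace (equivariant_discs G k I H)" for i c
    using that closedin_closed_eq[OF closed_disc] by (auto simp: topspace_equivariant_discs)
  moreover have "closedin (equivariant_discs G k I H) P \<longleftrightarrow>
     P \<subseteq> topspace (equivariant_discs G k I H) \<and>
     (\<forall>i\<in>I. \<forall>c\<in>rcosets\<^bsub>G\<^esub> (H i). closedin (top_of_set (disc k)) {d. (i, c, d) \<in> P})"
    unfolding topspace_equivariant_discs unfolding equivariant_discs_def
    by (auto simp: closedin_sum_topology closedin_prod_discrete unit_disc_eq)
  ultimately show ?thesis by blast
qed

text \<open>\<open>regular\<close> is what lets the open simplices themselves serve as equivariant
  cells; a simplex mapped to itself by a nontrivial permutation of its vertices would have to be
  subdivided. The action laws are demanded on vertices only, since \<open>vact\<close> is arbitrary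
  elsewhere.\<close>

locale regular_complex_action = group G for G (structure) +
  fixes K :: "'v set set" and vact :: "'v \<Rightarrow> 'a \<Rightarrow> 'v"
  assumes finite_simplex: "\<sigma> \<in> K \<Longrightarrow> finite \<sigma>"
    and faces: "\<lbrakk>\<sigma> \<in> K; \<tau> \<subseteq> \<sigma>; \<tau> \<noteq> {}\<rbrakk> \<Longrightarrow> \<tau> \<in> K"
    and image_simplex: "\<lbrakk>\<sigma> \<in> K; g \<in> carrier G\<rbrakk> \<Longrightarrow> (\<lambda>v. vact v g) ` \<sigma> \<in> K"
    and vact_one: "v \<in> \<Union>K \<Longrightarrow> vact v \<one> = v"
    and vact_mult: "\<lbrakk>v \<in> \<Union>K; g \<in> carrier G; h \<in> carrier G\<rbrakk> \<Longrightarrow> vact v (g \<otimes> h) = vact (vact v g) h"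
    and regular: "\<lbrakk>\<sigma> \<in> K; g \<in> carrier G; (\<lambda>v. vact v g) ` \<sigma> = \<sigma>; v \<in> \<sigma>\<rbrakk> \<Longrightarrow> vact v g = v"
begin

abbreviation X where "X \<equiv> geometric_realisation K"

definition act :: "('v \<Rightarrow> real) \<Rightarrow> 'a \<Rightarrow> 'v \<Rightarrow> real" where
  "act x g = affine_extension (\<lambda>v. vact v g) x"

abbreviation translate :: "'v set \<Rightarrow> 'a \<Rightarrow> 'v set" where
  "translate \<sigma> g \<equiv> (\<lambda>v. vact v g) ` \<sigma>"

lemma support_X:
  assumes "x \<in> topspace X"
  shows "support x \<in> K" "x \<in> geometric_simplex (support x)"
  using support_mem_subcomplex[OF finite_simplex _ assms] faces by blast+

lemma vact_inv: "\<lbrakk>v \<in> \<Union>K; g \<in> carrier G\<rbrakk> \<Longrightarrow> vact (vact v g) (inv g) = v"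
  using vact_mult[of v g "inv g"] vact_one by simp

lemma inj_vact:
  assumes "g \<in> carrier G" shows "inj_on (\<lambda>v. vact v g) (\<Union>K)"
  by (rule inj_on_inverseI[where g="\<lambda>v. vact v (inv g)"]) (rule vact_inv[OF _ assms])

lemma translate_mult:
  assumes "\<sigma> \<in> K" "g \<in> carrier G" "h \<in> carrier G"
  shows "translate \<sigma> (g \<otimes> h) = translate (translate \<sigma> g) h"
  unfolding image_image using assms vact_mult by (intro image_cong) auto

lemma translate_one: "\<sigma> \<in> K \<Longrightarrow> translate \<sigma> \<one> = \<sigma>"
  using vact_one by (subst image_cong[where g="\<lambda>v. v" and N=\<sigma>]) auto

lemma card_translate: "\<lbrakk>\<sigma> \<in> K; g \<in> carrier G\<rbrakk> \<Longrightarrow> card (translate \<sigma> g) = card \<sigma>"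
  by (intro card_image inj_on_subset[OF inj_vact]) auto

lemma
  assumes "x \<in> topspace X" "g \<in> carrier G"
  shows act_in_topspace: "act x g \<in> topspace X"
    and support_act: "support (act x g) = translate (support x) g"
proof -
  note x = support_X[OF assms(1)]
  show "act x g \<in> topspace X"
    using affine_extension_in_simplex[OF finite_simplex[OF x(1)] x(2)] image_simplex[OF x(1) assms(2)]
    by (auto simp: act_def)
  show "support (act x g) = translate (support x) g"
    unfolding act_def using x(1)
    by (intro support_affine_extension_inj[OF finite_simplex[OF x(1)] x(2)] inj_on_subset[OF inj_vact[OF assms(2)]]) auto
qed

lemma act_one: "x \<in> topspace X \<Longrightarrow> act x \<one> = x"
proof -
  assume "x \<in> topspace X"
  then have "act x \<one> = affine_extension (\<lambda>v. v) x"
    unfolding act_def using support_X(1) vact_one by (intro affine_extension_cong) blast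
  then show ?thesis by (simp add: affine_extension_id)
qed

lemma act_mult:
  assumes "x \<in> topspace X" "g \<in> carrier G" "h \<in> carrier G"
  shows "act x (g \<otimes> h) = act (act x g) h"
proof -
  note x = support_X[OF assms(1)]
  have "act x (g \<otimes> h) = affine_extension (\<lambda>v. vact (vact v g) h) x"
    unfolding act_def using vact_mult x(1) assms by (intro affine_extension_cong) auto
  then show ?thesis
    unfolding act_def by (simp add: affine_extension_comp[OF finite_simplex[OF x(1)] x(2)])
qed

lemma right_G_space_realisation: "right_G_space G X act"
  unfolding right_G_space_def
proof (intro conjI ballI)
  show "continuous_map X X (\<lambda>x. act x g)" if "g \<in> carrier G" for g
    unfolding act_def using continuous_map_affine_extension[of K "\<lambda>v. vact v g" K]
      finite_simplex image_simplex that by blast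
qed (use group_axioms act_one act_mult in auto)

text \<open>In general a simplicial map may fix a barycentre while permuting vertices. Here a fixed
  point has an invariant support, which is a simplex, and regularity applies to it.\<close>

lemma act_eq_iff:
  assumes x: "x \<in> topspace X" and g: "g \<in> carrier G"
  shows "act x g = x \<longleftrightarrow> (\<forall>v\<in>support x. vact v g = v)"
proof
  assume "act x g = x"
  then have "translate (support x) g = support x" using support_act[OF x g] by simp
  then show "\<forall>v\<in>support x. vact v g = v" using regular[OF support_X(1)[OF x] g] by blast
next
  assume "\<forall>v\<in>support x. vact v g = v"
  then have "act x g = affine_extension (\<lambda>v. v) x"
    unfolding act_def by (intro affine_extension_cong) auto
  then show "act x g = x" by (simp add: affine_extension_id)
qed

text \<open>At most k vertices means dimension at most k - 1, in agreement with the shifted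
  numbering of the filtration in \<open>G_CW_complex\<close>.\<close>

definition small_simplices :: "nat \<Rightarrow> 'v set set" where
  "small_simplices k = {\<sigma> \<in> K. card \<sigma> \<le> k}"

definition skeleton :: "nat \<Rightarrow> ('v \<Rightarrow> real) set" where
  "skeleton k = \<Union> (geometric_simplex ` small_simplices k)"

lemma small_simplices_faces:
  "\<lbrakk>\<sigma> \<in> small_simplices k; \<tau> \<subseteq> \<sigma>; \<tau> \<noteq> {}\<rbrakk> \<Longrightarrow> \<tau> \<in> small_simplices k"
  unfolding small_simplices_def using faces finite_simplex card_mono by (metis (no_types, lifting) mem_Collect_eq order_trans)

lemma skeleton_iff: "x \<in> skeleton k \<longleftrightarrow> x \<in> topspace X \<and> card (support x) \<le> k"
proof
  assume "x \<in> skeleton k"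
  then have x: "x \<in> topspace (geometric_realisation (small_simplices k))" by (simp add: skeleton_def)
  have fin: "finite \<sigma>" if "\<sigma> \<in> small_simplices k" for \<sigma>
    using that finite_simplex by (simp add: small_simplices_def)
  have "support x \<in> small_simplices k"
    using support_mem_subcomplex(1)[OF fin small_simplices_faces x] .
  moreover have "x \<in> topspace X" using x by (auto simp: small_simplices_def)
  ultimately show "x \<in> topspace X \<and> card (support x) \<le> k" by (simp add: small_simplices_def)
next
  assume "x \<in> topspace X \<and> card (support x) \<le> k"
  then show "x \<in> skeleton k"
    using support_X[of x] unfolding skeleton_def small_simplices_def by blast
qed

lemma
  shows closedin_skeleton: "closedin X (skeleton k)"
    and subtopology_skeleton: "subtopology X (skeleton k) = geometric_realisation (small_simplices k)"
proof -
  have sub: "small_simplices k \<subseteq> K" by (auto simp: small_simplices_def)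
  show "closedin X (skeleton k)"
    unfolding skeleton_def
    by (rule closedin_subcomplex, fact finite_simplex, fact sub, fact small_simplices_faces)
  show "subtopology X (skeleton k) = geometric_realisation (small_simplices k)"
    unfolding skeleton_def
    by (rule subtopology_subcomplex, fact finite_simplex, fact sub, fact small_simplices_faces)
qed

lemma closedin_skeleton_iff:
  assumes "C \<subseteq> skeleton k"
  shows "closedin X C \<longleftrightarrow> (\<forall>\<sigma>\<in>small_simplices k. closed (C \<inter> geometric_simplex \<sigma>))"
proof -
  have "closedin X C \<longleftrightarrow> closedin (subtopology X (skeleton k)) C"
    using closedin_closed_subtopology[OF closedin_skeleton] assms by blast
  then have "closedin X C \<longleftrightarrow> closedin (geometric_realisation (small_simplices k)) C"
    by (simp only: subtopology_skeleton)
  also have "\<dots> \<longleftrightarrow> (\<forall>\<sigma>\<in>small_simplices k. closed (C \<inter> geometric_simplex \<sigma>))"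
    using assms unfolding closedin_geometric_realisation skeleton_def by blast
  finally show ?thesis .
qed

end

section \<open>Equivariant cells\<close>

context regular_complex_action
begin

definition orbit :: "'v set \<Rightarrow> 'v set set" where
  "orbit \<sigma> = translate \<sigma> ` carrier G"

text \<open>The choice is made from the orbit as a set, so all simplices of one orbit get the same
  representative.\<close>

definition orbit_rep :: "'v set \<Rightarrow> 'v set" where
  "orbit_rep \<sigma> = (SOME \<tau>. \<tau> \<in> orbit \<sigma>)"

lemma orbit_translate:
  assumes \<sigma>: "\<sigma> \<in> K" and g: "g \<in> carrier G"
  shows "orbit (translate \<sigma> g) = orbit \<sigma>"
proof
  show "orbit (translate \<sigma> g) \<subseteq> orbit \<sigma>"
  proof
    fix \<tau> assume "\<tau> \<in> orbit (translate \<sigma> g)"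
    then obtain h where h: "h \<in> carrier G" "\<tau> = translate (translate \<sigma> g) h" by (auto simp: orbit_def)
    then have "\<tau> = translate \<sigma> (g \<otimes> h)" by (simp only: translate_mult[OF \<sigma> g])
    then show "\<tau> \<in> orbit \<sigma>" unfolding orbit_def using g h by blast
  qed
  show "orbit \<sigma> \<subseteq> orbit (translate \<sigma> g)"
  proof
    fix \<tau> assume "\<tau> \<in> orbit \<sigma>"
    then obtain h where h: "h \<in> carrier G" "\<tau> = translate \<sigma> h" by (auto simp: orbit_def)
    have "g \<otimes> (inv g \<otimes> h) = h" using g h by (simp flip: m_assoc)
    then have "\<tau> = translate (translate \<sigma> g) (inv g \<otimes> h)"
      using translate_mult[OF \<sigma> g, of "inv g \<otimes> h"] g h by simp
    then show "\<tau> \<in> orbit (translate \<sigma> g)"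
      unfolding orbit_def using g h by blast
  qed
qed

lemma orbit_rep:
  assumes \<sigma>: "\<sigma> \<in> K"
  obtains g where "g \<in> carrier G" "orbit_rep \<sigma> = translate \<sigma> g"
proof -
  have "translate \<sigma> \<one> \<in> orbit \<sigma>" unfolding orbit_def by blast
  then have "orbit_rep \<sigma> \<in> orbit \<sigma>" unfolding orbit_rep_def by (rule someI)
  then show ?thesis using that by (auto simp: orbit_def)
qed

lemma orbit_rep_translate: "\<lbrakk>\<sigma> \<in> K; g \<in> carrier G\<rbrakk> \<Longrightarrow> orbit_rep (translate \<sigma> g) = orbit_rep \<sigma>"
  by (simp add: orbit_rep_def orbit_translate)

text \<open>Cells must be indexed by points of the space: the barycentre encodes a simplex as a
  point, and \<open>support\<close> decodes it.\<close>

definition barycentre :: "'v set \<Rightarrow> 'v \<Rightarrow> real" where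
  "barycentre \<sigma> v = (if v \<in> \<sigma> then 1 / card \<sigma> else 0)"

definition cell_index :: "nat \<Rightarrow> ('v \<Rightarrow> real) set" where
  "cell_index k = (\<lambda>\<sigma>. barycentre (orbit_rep \<sigma>)) ` {\<sigma> \<in> K. card \<sigma> = Suc k}"

lemma cell_indexE:
  assumes "i \<in> cell_index k"
  obtains "support i \<in> K" "card (support i) = Suc k" "orbit_rep (support i) = support i"
    "i = barycentre (support i)"
proof -
  from assms obtain \<sigma> where \<sigma>: "\<sigma> \<in> K" "card \<sigma> = Suc k" "i = barycentre (orbit_rep \<sigma>)"
    by (auto simp: cell_index_def)
  obtain g where g: "g \<in> carrier G" "orbit_rep \<sigma> = translate \<sigma> g"
    using orbit_rep[OF \<sigma>(1)] .
  have c: "card (orbit_rep \<sigma>) = Suc k" using card_translate \<sigma> g by simp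
  then have s: "support i = orbit_rep \<sigma>" by (auto simp: support_def barycentre_def \<sigma>(3))
  show ?thesis
  proof (rule that)
    show "support i \<in> K" unfolding s g(2) by (rule image_simplex[OF \<sigma>(1) g(1)])
    show "card (support i) = Suc k" using c s by simp
    show "orbit_rep (support i) = support i"
      unfolding s using orbit_rep_translate[OF \<sigma>(1) g(1)] g(2) by simp
    show "i = barycentre (support i)" using s \<sigma>(3) by simp
  qed
qed

lemma cell_index_unique:
  assumes "i \<in> cell_index k" "j \<in> cell_index k" "g \<in> carrier G" "h \<in> carrier G"
    and eq: "translate (support i) g = translate (support j) h"
  shows "i = j"
proof -
  have "orbit_rep (support i) = orbit_rep (support j)"
    using orbit_rep_translate assms by (metis cell_indexE)
  then show ?thesis using assms(1,2) by (metis cell_indexE)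
qed

lemma cell_index_exists:
  assumes \<sigma>: "\<sigma> \<in> K" "card \<sigma> = Suc k"
  obtains i g where "i \<in> cell_index k" "g \<in> carrier G" "\<sigma> = translate (support i) g"
proof -
  obtain g where g: "g \<in> carrier G" "orbit_rep \<sigma> = translate \<sigma> g"
    using orbit_rep[OF \<sigma>(1)] .
  define i where "i = barycentre (orbit_rep \<sigma>)"
  have i: "i \<in> cell_index k" using \<sigma> by (auto simp: i_def cell_index_def)
  have "card (orbit_rep \<sigma>) = Suc k" using card_translate \<sigma> g by simp
  then have "support i = orbit_rep \<sigma>" by (auto simp: support_def barycentre_def i_def)
  then have "translate (support i) (inv g) = translate \<sigma> (g \<otimes> inv g)"
    using translate_mult[OF \<sigma>(1) g(1), of "inv g"] g by simp
  also have "\<dots> = \<sigma>" using translate_one[OF \<sigma>(1)] g by simp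
  finally show ?thesis using that[OF i inv_closed[OF g(1)]] by simp
qed

text \<open>For a simplex of K, regularity makes this pointwise stabiliser coincide with the setwise
  one.\<close>

definition stabiliser :: "'v set \<Rightarrow> 'a set" where
  "stabiliser \<sigma> = {g \<in> carrier G. \<forall>v\<in>\<sigma>. vact v g = v}"

lemma subgroup_stabiliser:
  assumes "\<sigma> \<in> K" shows "subgroup (stabiliser \<sigma>) G"
proof (rule subgroupI)
  have v: "v \<in> \<Union>K" if "v \<in> \<sigma>" for v using assms that by blast
  show "stabiliser \<sigma> \<subseteq> carrier G" by (auto simp: stabiliser_def)
  show "stabiliser \<sigma> \<noteq> {}" using vact_one[OF v] by (auto simp: stabiliser_def)
  show "inv a \<in> stabiliser \<sigma>" if "a \<in> stabiliser \<sigma>" for a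
    using that vact_inv[OF v, of _ a] by (auto simp: stabiliser_def)
  show "a \<otimes> b \<in> stabiliser \<sigma>" if "a \<in> stabiliser \<sigma>" "b \<in> stabiliser \<sigma>" for a b
    using that vact_mult[OF v, of _ a b] by (auto simp: stabiliser_def)
qed

text \<open>One arbitrary numbering is fixed per orbit representative; translated cells carry the
  numbering along with g. This is what makes the cell map equivariant.\<close>

definition cell_vertex :: "nat \<Rightarrow> ('v \<Rightarrow> real) \<Rightarrow> nat \<Rightarrow> 'v" where
  "cell_vertex k i = (SOME e. bij_betw e {..k} (support i))"

lemma cell_vertex:
  assumes "i \<in> cell_index k" shows "bij_betw (cell_vertex k i) {..k} (support i)"
proof -
  obtain "support i \<in> K" "card (support i) = Suc k"
    using assms by (rule cell_indexE)
  then have "\<exists>e. bij_betw e {..k} (support i)"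
    using finite_simplex by (intro finite_same_card_bij) auto
  then show ?thesis unfolding cell_vertex_def by (rule someI_ex)
qed

definition characteristic_map :: "nat \<Rightarrow> ('v \<Rightarrow> real) \<Rightarrow> 'a \<Rightarrow> (nat \<Rightarrow> real) \<Rightarrow> 'v \<Rightarrow> real" where
  "characteristic_map k i g d = affine_extension (\<lambda>j. vact (cell_vertex k i j) g) (disc_to_simplex k d)"

definition cell_map :: "nat \<Rightarrow> ('v \<Rightarrow> real) \<times> 'a set \<times> (nat \<Rightarrow> real) \<Rightarrow> 'v \<Rightarrow> real" where
  "cell_map k = (\<lambda>(i, c, d). characteristic_map k i (SOME g. g \<in> c) d)"

text \<open>The chosen representative is h \<otimes> g with h in the stabiliser. Since the action is
  on the right, h acts before g, and it fixes every vertex of the cell.\<close>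

lemma cell_map_coset:
  assumes i: "i \<in> cell_index k" and g: "g \<in> carrier G" and d: "d \<in> disc k"
  shows "cell_map k (i, stabiliser (support i) #> g, d) = characteristic_map k i g d"
proof -
  obtain iK: "support i \<in> K" using i by (rule cell_indexE)
  define g' where "g' = (SOME g'. g' \<in> stabiliser (support i) #> g)"
  have "g \<in> stabiliser (support i) #> g"
    using rcos_self[OF g subgroup_stabiliser[OF iK]] .
  then have "g' \<in> stabiliser (support i) #> g" unfolding g'_def by (rule someI)
  then obtain h where h: "h \<in> stabiliser (support i)" "g' = h \<otimes> g" by (auto simp: r_coset_def)
  have "vact (cell_vertex k i j) g' = vact (cell_vertex k i j) g" if "j \<in> support (disc_to_simplex k d)" for j
  proof -
    have "j \<in> {..k}" using geometric_simplexD(4)[OF disc_to_simplex_in_simplex[OF d]] that by blast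
    then have "cell_vertex k i j \<in> support i" using bij_betwE[OF cell_vertex[OF i]] by blast
    then show ?thesis
      using h g iK vact_mult[of "cell_vertex k i j" h g] by (auto simp: stabiliser_def)
  qed
  then show ?thesis
    by (simp add: cell_map_def characteristic_map_def flip: g'_def cong: affine_extension_cong)
qed

section \<open>A single translated cell\<close>

context
  fixes k i g assumes i: "i \<in> cell_index k" and g: "g \<in> carrier G"
begin

lemma inj_cell: "inj_on (\<lambda>j. vact (cell_vertex k i j) g) {..k}"
  and image_cell: "(\<lambda>j. vact (cell_vertex k i j) g) ` {..k} = translate (support i) g"
proof -
  obtain iK: "support i \<in> K" using i by (rule cell_indexE)
  have b: "inj_on (cell_vertex k i) {..k}" "cell_vertex k i ` {..k} = support i"
    using cell_vertex[OF i] by (auto simp: bij_betw_def)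
  then have "inj_on (\<lambda>v. vact v g) (cell_vertex k i ` {..k})"
    using inj_on_subset[OF inj_vact[OF g]] iK by blast
  from comp_inj_on[OF b(1) this] show "inj_on (\<lambda>j. vact (cell_vertex k i j) g) {..k}"
    by (simp add: o_def)
  show "(\<lambda>j. vact (cell_vertex k i j) g) ` {..k} = translate (support i) g"
    unfolding b(2)[symmetric] image_image ..
qed

lemma translate_cell: "translate (support i) g \<in> K" "card (translate (support i) g) = Suc k"
proof -
  obtain "support i \<in> K" "card (support i) = Suc k" using i by (rule cell_indexE)
  then show "translate (support i) g \<in> K" "card (translate (support i) g) = Suc k"
    using image_simplex[OF _ g] card_translate[OF _ g] by simp_all
qed

lemma characteristic_map_in_simplex:
  "d \<in> disc k \<Longrightarrow> characteristic_map k i g d \<in> geometric_simplex (translate (support i) g)"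
  unfolding characteristic_map_def image_cell[symmetric]
  by (intro affine_extension_in_simplex disc_to_simplex_in_simplex) auto

lemma support_characteristic_map:
  assumes d: "d \<in> disc k"
  shows "d \<notin> disc_boundary k \<Longrightarrow> support (characteristic_map k i g d) = translate (support i) g"
    and "d \<in> disc_boundary k \<Longrightarrow> card (support (characteristic_map k i g d)) \<le> k"
proof -
  let ?s = "support (disc_to_simplex k d)"
  have eq: "support (characteristic_map k i g d) = (\<lambda>j. vact (cell_vertex k i j) g) ` ?s"
    unfolding characteristic_map_def
    by (rule support_affine_extension_inj[OF _ disc_to_simplex_in_simplex[OF d] inj_cell]) simp
  show "support (characteristic_map k i g d) = translate (support i) g" if "d \<notin> disc_boundary k"
    using eq support_disc_to_simplex[OF d] that image_cell by simp
  show "card (support (characteristic_map k i g d)) \<le> k" if "d \<in> disc_boundary k"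
  proof -
    have "?s \<subset> {..k}"
      using support_disc_to_simplex[OF d] that geometric_simplexD(4)[OF disc_to_simplex_in_simplex[OF d]]
      by blast
    then have "card ?s < card {..k}" by (intro psubset_card_mono) auto
    moreover have "card ((\<lambda>j. vact (cell_vertex k i j) g) ` ?s) \<le> card ?s"
      using \<open>?s \<subset> {..k}\<close> by (intro card_image_le) (auto intro: finite_subset)
    ultimately show ?thesis unfolding eq by simp
  qed
qed

lemma continuous_on_characteristic_map:
  "continuous_map (top_of_set (disc k)) euclidean (characteristic_map k i g)"
proof -
  have "continuous_on (disc k) (\<lambda>d. characteristic_map k i g d w)" for w
  proof -
    have "continuous_on (disc k)
        (\<lambda>d. \<Sum>j | j \<in> {..k} \<and> vact (cell_vertex k i j) g = w. disc_to_simplex k d j)"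
      by (intro continuous_on_sum continuous_on_disc_to_simplex)
    then show ?thesis
      unfolding characteristic_map_def
      by (rule continuous_on_eq)
        (rule affine_extension_eq_sum[OF finite_atMost geometric_simplexD(4)[OF disc_to_simplex_in_simplex], symmetric])
  qed
  then show ?thesis by (simp add: continuous_map_fun_componentwise)
qed

lemma characteristic_map_surj:
  assumes x: "x \<in> geometric_simplex (translate (support i) g)"
  obtains d where "d \<in> disc k" "x = characteristic_map k i g d"
proof -
  let ?\<phi> = "\<lambda>j. vact (cell_vertex k i j) g"
  note xD = geometric_simplexD[OF x]
  \<comment> \<open>The coordinates of x are pulled back along the vertex numbering to the standard
    simplex, where \<open>disc_to_simplex\<close> is onto.\<close>
  define f where "f j = (if j \<le> k then x (?\<phi> j) else 0)" for j
  have "(\<Sum>j\<le>k. f j) = sum x (?\<phi> ` {..k})"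
    unfolding sum.reindex[OF inj_cell] f_def by simp
  then have f: "f \<in> geometric_simplex {..k}"
    using xD(1,3) by (simp add: geometric_simplex_def image_cell f_def)
  then obtain d where d: "d \<in> disc k" "disc_to_simplex k d = f" using disc_to_simplex_surj by blast
  have "characteristic_map k i g d w = x w" for w
  proof (cases "w \<in> ?\<phi> ` {..k}")
    case True
    then obtain j where "j \<in> {..k}" "w = ?\<phi> j" by blast
    then show ?thesis
      using affine_extension_inj[OF _ f inj_cell, of j] by (simp add: characteristic_map_def d(2)) (simp add: f_def)
  next
    case False
    then have "w \<notin> translate (support i) g" using image_cell by blast
    then show ?thesis
      using xD(2) geometric_simplexD(2)[OF characteristic_map_in_simplex[OF d(1)]] by simp
  qed
  then show ?thesis using that[OF d(1)] by (auto simp: fun_eq_iff)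
qed

lemma characteristic_map_inj:
  assumes d: "d \<in> disc k - disc_boundary k" "d' \<in> disc k - disc_boundary k"
    and eq: "characteristic_map k i g d = characteristic_map k i g d'"
  shows "d = d'"
proof (rule disc_to_simplex_inj[OF d])
  have dk: "d \<in> disc k" "d' \<in> disc k" using d by auto
  show "disc_to_simplex k d = disc_to_simplex k d'"
  proof
    fix j
    show "disc_to_simplex k d j = disc_to_simplex k d' j"
    proof (cases "j \<le> k")
      case True
      then show ?thesis
        using affine_extension_inj[OF _ disc_to_simplex_in_simplex[OF dk(1)] inj_cell, of j]
          affine_extension_inj[OF _ disc_to_simplex_in_simplex[OF dk(2)] inj_cell, of j] eq
        by (simp add: characteristic_map_def)
    qed (simp add: disc_to_simplex_def)
  qed
qed

lemma act_characteristic_map: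
  assumes d: "d \<in> disc k" and h: "h \<in> carrier G"
  shows "act (characteristic_map k i g d) h = characteristic_map k i (g \<otimes> h) d"
proof -
  obtain iK: "support i \<in> K" using i by (rule cell_indexE)
  have "act (characteristic_map k i g d) h
      = affine_extension (\<lambda>j. vact (vact (cell_vertex k i j) g) h) (disc_to_simplex k d)"
    unfolding act_def characteristic_map_def
    by (rule affine_extension_comp[OF _ disc_to_simplex_in_simplex[OF d]]) simp
  also have "\<dots> = characteristic_map k i (g \<otimes> h) d"
    unfolding characteristic_map_def
  proof (rule affine_extension_cong)
    fix j assume "j \<in> support (disc_to_simplex k d)"
    then have "j \<in> {..k}" using geometric_simplexD(4)[OF disc_to_simplex_in_simplex[OF d]] by blast
    then have "cell_vertex k i j \<in> \<Union>K" using bij_betwE[OF cell_vertex[OF i]] iK by blast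
    then show "vact (vact (cell_vertex k i j) g) h = vact (cell_vertex k i j) (g \<otimes> h)"
      using vact_mult g h by simp
  qed
  finally show ?thesis .
qed

end

lemma attaches_cells_skeleton:
  "attaches_equivariant_cells G X act k (skeleton k) (skeleton (Suc k))"
proof -
  let ?I = "cell_index k" and ?H = "\<lambda>i. stabiliser (support i)" and ?Q = "cell_map k"
  let ?D = "equivariant_discs G k ?I ?H" and ?S = "equivariant_spheres G k ?I ?H"
  have H: "subgroup (?H i) G" if "i \<in> ?I" for i
    using that by (auto elim!: cell_indexE intro: subgroup_stabiliser)
  \<comment> \<open>Presents a point of the disc space with an explicit group element, so that the
    choice hidden in \<open>cell_map\<close> no longer appears.\<close>
  have cosetE: thesis if "p \<in> topspace ?D"
      and "\<And>i g d. \<lbrakk>i \<in> ?I; g \<in> carrier G; d \<in> disc k; p = (i, ?H i #> g, d);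
            ?Q p = characteristic_map k i g d\<rbrakk> \<Longrightarrow> thesis" for p thesis
  proof -
    from that(1) obtain i g d where p: "i \<in> ?I" "g \<in> carrier G" "d \<in> disc k" "p = (i, ?H i #> g, d)"
      by (auto simp: topspace_equivariant_discs RCOSETS_def)
    show thesis using that(2)[OF p] cell_map_coset[OF p(1-3)] p(4) by simp
  qed
  have Q_in: "?Q p \<in> skeleton (Suc k)" if "p \<in> topspace ?D" for p
    using that
  proof (rule cosetE)
    fix i g d assume i: "i \<in> ?I" "g \<in> carrier G" "d \<in> disc k" and p: "?Q p = characteristic_map k i g d"
    then show ?thesis
      unfolding p skeleton_def small_simplices_def
      using characteristic_map_in_simplex[OF i] translate_cell[OF i(1,2)] by auto
  qed
  have interior: "p \<in> topspace ?D - ?S \<longleftrightarrow> p \<in> topspace ?D \<and> snd (snd p) \<notin> disc_boundary k" for p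
    by (cases p) (auto simp: topspace_equivariant_discs equivariant_spheres_def)
  have sub: "skeleton k \<subseteq> skeleton (Suc k)"
    by (auto simp: skeleton_iff)
  have fibre_closed: "closed {d. (i, c, d) \<in> topspace ?D \<and> ?Q (i, c, d) \<in> C}"
    if C: "closedin X C" and i: "i \<in> ?I" and c: "c \<in> rcosets (?H i)" for C i c
  proof -
    obtain g where g: "g \<in> carrier G" "c = ?H i #> g" using c by (auto simp: RCOSETS_def)
    have "continuous_map (top_of_set (disc k)) X (characteristic_map k i g)"
      using characteristic_map_in_simplex[OF i g(1)] translate_cell[OF i g(1)]
      by (intro continuous_map_into_realisation[where T="{translate (support i) g}"]
          continuous_on_characteristic_map i g) auto
    from closedin_continuous_map_preimage[OF this C]
    have "closed {d \<in> disc k. characteristic_map k i g d \<in> C}"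
      using closedin_closed_trans[OF _ closed_disc] by simp
    moreover have "{d. (i, c, d) \<in> topspace ?D \<and> ?Q (i, c, d) \<in> C} = {d \<in> disc k. characteristic_map k i g d \<in> C}"
    proof (intro Collect_cong)
      fix d
      have "(i, c, d) \<in> topspace ?D \<longleftrightarrow> d \<in> disc k"
        using i c by (simp add: topspace_equivariant_discs)
      then show "(i, c, d) \<in> topspace ?D \<and> ?Q (i, c, d) \<in> C \<longleftrightarrow> d \<in> disc k \<and> characteristic_map k i g d \<in> C"
        using cell_map_coset[OF i g(1)] g(2) by metis
    qed
    ultimately show ?thesis by simp
  qed
  have preimage_closed: "closedin ?D {p \<in> topspace ?D. ?Q p \<in> C}" if "closedin X C" for C
    unfolding closedin_equivariant_discs mem_Collect_eq using fibre_closed[OF that] by blast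
  \<comment> \<open>The half of the final topology with content. Closedness is tested on each
    simplex: those with at most k vertices are covered by the hypothesis on the k-th stage, the
    others are images of discs.\<close>
  have closed_of_preimage: "closedin X C"
    if C: "C \<subseteq> skeleton (Suc k)" "closedin X (C \<inter> skeleton k)" "closedin ?D {p \<in> topspace ?D. ?Q p \<in> C}" for C
    unfolding closedin_skeleton_iff[OF C(1)]
  proof
    fix \<sigma> assume "\<sigma> \<in> small_simplices (Suc k)"
    then have \<sigma>: "\<sigma> \<in> K" "card \<sigma> \<le> Suc k" by (auto simp: small_simplices_def)
    show "closed (C \<inter> geometric_simplex \<sigma>)"
    proof (cases "card \<sigma> \<le> k")
      case True
      then have "\<sigma> \<in> small_simplices k" using \<sigma> by (simp add: small_simplices_def)
      then have "closed ((C \<inter> skeleton k) \<inter> geometric_simplex \<sigma>)" "geometric_simplex \<sigma> \<subseteq> skeleton k"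
        using C(2) closedin_skeleton_iff[of "C \<inter> skeleton k" k] by (auto simp: skeleton_def)
      then show ?thesis by (metis Int_assoc inf.absorb2)
    next
      case False
      then have "card \<sigma> = Suc k" using \<sigma>(2) by simp
      then obtain i g where i: "i \<in> ?I" "g \<in> carrier G" and \<sigma>_eq: "\<sigma> = translate (support i) g"
        using cell_index_exists[OF \<sigma>(1)] by blast
      have c: "?H i #> g \<in> rcosets (?H i)" using i by (auto simp: RCOSETS_def)
      let ?E = "{d \<in> disc k. characteristic_map k i g d \<in> C}"
      have "closed {d. (i, ?H i #> g, d) \<in> {p \<in> topspace ?D. ?Q p \<in> C}}"
        using C(3) i c unfolding closedin_equivariant_discs by blast
      moreover have "(i, ?H i #> g, d) \<in> {p \<in> topspace ?D. ?Q p \<in> C} \<longleftrightarrow> d \<in> ?E" for d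
      proof -
        have "(i, ?H i #> g, d) \<in> topspace ?D \<longleftrightarrow> d \<in> disc k"
          using i(1) c by (simp add: topspace_equivariant_discs)
        then show ?thesis using cell_map_coset[OF i] by (metis (no_types, lifting) mem_Collect_eq)
      qed
      ultimately have "closed ?E" by simp
      \<comment> \<open>A closed part of the compact disc has compact, hence closed, image; the
        image of ?E is the trace of C on \<sigma>.\<close>
      moreover have "disc k \<inter> ?E = ?E" by blast
      ultimately have "compact ?E" using compact_Int_closed[OF compact_disc[of k], of ?E] by argo
      moreover have "continuous_on ?E (characteristic_map k i g)"
        using continuous_on_characteristic_map[OF i] by (auto intro: continuous_on_subset)
      ultimately have "closed (characteristic_map k i g ` ?E)"
        by (intro compact_imp_closed_fun compact_continuous_image)
      moreover have "characteristic_map k i g ` ?E = C \<inter> geometric_simplex \<sigma>"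
      proof
        show "characteristic_map k i g ` ?E \<subseteq> C \<inter> geometric_simplex \<sigma>"
          using characteristic_map_in_simplex[OF i] \<sigma>_eq by auto
        show "C \<inter> geometric_simplex \<sigma> \<subseteq> characteristic_map k i g ` ?E"
          using characteristic_map_surj[OF i] \<sigma>_eq by blast
      qed
      ultimately show ?thesis by simp
    qed
  qed
  have closed_sub: "closedin (subtopology X (skeleton j)) C \<longleftrightarrow> closedin X C" if "C \<subseteq> skeleton j" for C j
    using closedin_closed_subtopology[OF closedin_skeleton] that by blast
  show ?thesis
    unfolding attaches_equivariant_cells_def
  proof (intro conjI exI[of _ ?I] exI[of _ ?H] exI[of _ ?Q] sub)
    show "\<forall>i\<in>?I. subgroup (?H i) G" using H by blast
    show "continuous_map ?D (subtopology X (skeleton (Suc k))) ?Q"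
      unfolding continuous_map_closedin
    proof (intro conjI allI impI)
      show "?Q \<in> topspace ?D \<rightarrow> topspace (subtopology X (skeleton (Suc k)))"
        using Q_in skeleton_iff by auto
      show "closedin ?D {p \<in> topspace ?D. ?Q p \<in> C}" if "closedin (subtopology X (skeleton (Suc k))) C" for C
        using that closedin_closed_subtopology[OF closedin_skeleton] preimage_closed by blast
    qed
    show "\<forall>(i, c, d)\<in>topspace ?D. \<forall>g\<in>carrier G. ?Q (i, c #> g, d) = act (?Q (i, c, d)) g"
    proof clarify
      fix i c d h assume p: "(i, c, d) \<in> topspace ?D" and h: "h \<in> carrier G"
      from p show "?Q (i, c #> h, d) = act (?Q (i, c, d)) h"
      proof (rule cosetE)
        fix i' g d' assume *: "i' \<in> ?I" "g \<in> carrier G" "d' \<in> disc k" "(i, c, d) = (i', ?H i' #> g, d')"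
          "?Q (i, c, d) = characteristic_map k i' g d'"
        then have "c #> h = ?H i #> (g \<otimes> h)"
          using coset_mult_assoc[OF subgroup.subset[OF H] _ h] by simp
        then show ?thesis
          using * h cell_map_coset[of i k "g \<otimes> h" d] act_characteristic_map[of i k g d h] by simp
      qed
    qed
    show "?Q ` ?S \<subseteq> skeleton k"
    proof clarify
      fix i c d assume S: "(i, c, d) \<in> ?S"
      then have p: "(i, c, d) \<in> topspace ?D" and d: "d \<in> disc_boundary k"
        by (auto simp: topspace_equivariant_discs equivariant_spheres_def disc_boundary_eq)
      from p show "?Q (i, c, d) \<in> skeleton k"
        by (rule cosetE) (use d Q_in[OF p] support_characteristic_map(2) in \<open>auto simp: skeleton_iff\<close>)
    qed
    show "bij_betw ?Q (topspace ?D - ?S) (skeleton (Suc k) - skeleton k)"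
    proof (rule bij_betw_imageI)
      show "inj_on ?Q (topspace ?D - ?S)"
      proof (rule inj_onI)
        fix p p' assume p: "p \<in> topspace ?D - ?S" and p': "p' \<in> topspace ?D - ?S" and eq: "?Q p = ?Q p'"
        obtain i g d where i: "i \<in> ?I" "g \<in> carrier G" "d \<in> disc k" "p = (i, ?H i #> g, d)"
            "?Q p = characteristic_map k i g d"
          using cosetE p by blast
        obtain i' g' d' where i': "i' \<in> ?I" "g' \<in> carrier G" "d' \<in> disc k" "p' = (i', ?H i' #> g', d')"
            "?Q p' = characteristic_map k i' g' d'"
          using cosetE p' by blast
        have d: "d \<in> disc k - disc_boundary k" "d' \<in> disc k - disc_boundary k"
          using p p' interior i i' by auto
        have "characteristic_map k i g d = characteristic_map k i' g' d'" using eq i(5) i'(5) by simp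
        \<comment> \<open>An interior point has the whole translated simplex as its support, so
          equal images lie in the same open simplex. Its orbit determines the cell index.\<close>
        then have tr: "translate (support i) g = translate (support i') g'"
          using support_characteristic_map(1)[OF i(1,2,3)] support_characteristic_map(1)[OF i'(1,2,3)] d
          by (metis DiffD2)
        then have ii: "i' = i" using cell_index_unique i i' by metis
        obtain iK: "support i \<in> K" using i(1) by (rule cell_indexE)
        \<comment> \<open>Now \<open>g \<otimes> inv g'\<close> maps the simplex to itself. By
          regularity it lies in the stabiliser, so the two cosets agree and only injectivity on a
          single disc remains.\<close>
        have "translate (support i) (g \<otimes> inv g') = translate (support i) (g' \<otimes> inv g')"
          unfolding translate_mult[OF iK i(2) inv_closed[OF i'(2)]]
            translate_mult[OF iK i'(2) inv_closed[OF i'(2)]] tr[unfolded ii] ..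
        then have "translate (support i) (g \<otimes> inv g') = support i"
          using translate_one[OF iK] i'(2) by simp
        then have st: "g \<otimes> inv g' \<in> ?H i"
          using regular[OF iK] i(2) i'(2) by (simp add: stabiliser_def)
        have "g = (g \<otimes> inv g') \<otimes> g'" using i(2) i'(2) by (simp add: m_assoc)
        then have "g \<in> ?H i #> g'" using st by (auto simp: r_coset_def)
        then have co: "?H i #> g' = ?H i #> g"
          using repr_independence[OF _ i'(2) H[OF i(1)]] by simp
        have "?Q p' = characteristic_map k i g d'"
          using cell_map_coset[OF i(1,2) i'(3)] i'(4) ii co by simp
        then have "d = d'"
          using characteristic_map_inj[OF i(1,2) d] eq i(5) by simp
        then show "p = p'" using i(4) i'(4) ii co by simp
      qed
      show "?Q ` (topspace ?D - ?S) = skeleton (Suc k) - skeleton k"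
      proof
        show "?Q ` (topspace ?D - ?S) \<subseteq> skeleton (Suc k) - skeleton k"
        proof clarify
          fix i c d assume p: "(i, c, d) \<in> topspace ?D" "(i, c, d) \<notin> ?S"
          then have d: "d \<notin> disc_boundary k" using interior[of "(i, c, d)"] by simp
          from p(1) have "card (support (?Q (i, c, d))) = Suc k"
            by (rule cosetE) (use d support_characteristic_map(1) translate_cell(2) in auto)
          then show "?Q (i, c, d) \<in> skeleton (Suc k) - skeleton k"
            using Q_in[OF p(1)] by (simp add: skeleton_iff)
        qed
        show "skeleton (Suc k) - skeleton k \<subseteq> ?Q ` (topspace ?D - ?S)"
        proof
          fix x assume "x \<in> skeleton (Suc k) - skeleton k"
          then have x: "x \<in> topspace X" "card (support x) = Suc k" by (auto simp: skeleton_iff)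
          obtain i g where i: "i \<in> ?I" "g \<in> carrier G" "support x = translate (support i) g"
            using cell_index_exists[OF support_X(1)[OF x(1)] x(2)] .
          obtain d where d: "d \<in> disc k" "x = characteristic_map k i g d"
            using characteristic_map_surj[OF i(1,2)] support_X(2)[OF x(1)] i(3) by metis
          have "d \<notin> disc_boundary k"
            using support_characteristic_map(2)[OF i(1,2) d(1)] d(2) x(2) by auto
          then have "(i, ?H i #> g, d) \<in> topspace ?D - ?S"
            unfolding interior using i d by (auto simp: topspace_equivariant_discs RCOSETS_def)
          moreover have "x = ?Q (i, ?H i #> g, d)" using cell_map_coset[OF i(1,2) d(1)] d(2) by simp
          ultimately show "x \<in> ?Q ` (topspace ?D - ?S)" by blast
        qed
      qed
    qed
    show "\<forall>C\<subseteq>skeleton (Suc k). closedin (subtopology X (skeleton (Suc k))) C \<longleftrightarrow>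
        closedin (subtopology X (skeleton k)) (C \<inter> skeleton k) \<and> closedin ?D {p \<in> topspace ?D. ?Q p \<in> C}"
    proof (intro allI impI)
      fix C assume C: "C \<subseteq> skeleton (Suc k)"
      have "closedin X C \<longleftrightarrow> closedin X (C \<inter> skeleton k) \<and> closedin ?D {p \<in> topspace ?D. ?Q p \<in> C}"
        using preimage_closed[of C] closed_of_preimage[OF C] closedin_Int[OF _ closedin_skeleton, of C k]
        by blast
      then show "closedin (subtopology X (skeleton (Suc k))) C \<longleftrightarrow>
          closedin (subtopology X (skeleton k)) (C \<inter> skeleton k) \<and> closedin ?D {p \<in> topspace ?D. ?Q p \<in> C}"
        by (simp only: closed_sub[OF C] closed_sub[of "C \<inter> skeleton k" k, OF Int_lower2])
    qed
  qed
qed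

theorem G_CW_complex_realisation: "G_CW_complex G X act"
  unfolding G_CW_complex_def
proof (intro conjI exI[of _ skeleton] right_G_space_realisation allI impI ballI attaches_cells_skeleton)
  have "support x \<noteq> {}" "finite (support x)" if "x \<in> topspace X" for x
    using support_nonempty[OF support_X(2)[OF that]] finite_simplex[OF support_X(1)[OF that]] by auto
  then show "skeleton 0 = {}"
    by (auto simp: skeleton_iff card_eq_0_iff simp del: topspace_geometric_realisation)
  show "(\<Union>k. skeleton k) = topspace X" by (auto simp: skeleton_iff)
  show "act x g \<in> skeleton k" if "x \<in> skeleton k" "g \<in> carrier G" for k x g
    using that by (auto simp: skeleton_iff act_in_topspace support_act card_translate support_X
        simp del: topspace_geometric_realisation)
  fix C assume C: "C \<subseteq> topspace X"
  show "closedin X C \<longleftrightarrow> (\<forall>k. closedin (subtopology X (skeleton k)) (C \<inter> skeleton k))"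
  proof
    assume "closedin X C"
    then show "\<forall>k. closedin (subtopology X (skeleton k)) (C \<inter> skeleton k)"
      by (metis Int_commute closedin_subtopology_Int_closed)
  next
    assume *: "\<forall>k. closedin (subtopology X (skeleton k)) (C \<inter> skeleton k)"
    have "closed (C \<inter> geometric_simplex \<sigma>)" if "\<sigma> \<in> K" for \<sigma>
    proof -
      \<comment> \<open>Each simplex lies entirely in one skeleton, so the test on skeleta contains
        the test on simplices.\<close>
      have \<sigma>: "\<sigma> \<in> small_simplices (card \<sigma>)" using that by (simp add: small_simplices_def)
      have "closed ((C \<inter> skeleton (card \<sigma>)) \<inter> geometric_simplex \<sigma>)"
        using * \<sigma> unfolding subtopology_skeleton closedin_geometric_realisation by blast
      moreover have "geometric_simplex \<sigma> \<subseteq> skeleton (card \<sigma>)" using \<sigma> by (auto simp: skeleton_def)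
      ultimately show ?thesis by (metis Int_assoc inf.absorb2)
    qed
    then show "closedin X C" using C by (simp add: closedin_geometric_realisation)
  qed
qed

end

section \<open>Realisations of join semilattices are contractible\<close>

lemma order_complex_finite: "\<sigma> \<in> order_complex r \<Longrightarrow> finite \<sigma>"
  by (simp add: order_complex_def)

lemma order_complex_face: "\<lbrakk>\<sigma> \<in> order_complex r; \<tau> \<subseteq> \<sigma>; \<tau> \<noteq> {}\<rbrakk> \<Longrightarrow> \<tau> \<in> order_complex r"
  by (auto simp: order_complex_def Chains_def intro: finite_subset)

lemma order_complex_Field: "\<sigma> \<in> order_complex r \<Longrightarrow> \<sigma> \<subseteq> Field r"
  by (auto simp: order_complex_def Chains_def Field_def)

lemma order_complex_total: "\<lbrakk>\<sigma> \<in> order_complex r; u \<in> \<sigma>; v \<in> \<sigma>\<rbrakk> \<Longrightarrow> (u, v) \<in> r \<or> (v, u) \<in> r"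
  by (auto simp: order_complex_def Chains_def)

lemma order_complex_image:
  assumes "\<sigma> \<in> order_complex r" "\<And>u v. (u, v) \<in> r \<Longrightarrow> (f u, f v) \<in> s"
  shows "f ` \<sigma> \<in> order_complex s"
  using assms by (fastforce simp: order_complex_def Chains_def)

text \<open>A product with a weak topology need not be tested simplex by simplex; with the interval
  as other factor it may, because the interval is locally compact. Around (t, x) a compact interval
  J is chosen with J x {x} inside the preimage of U, and the tube lemma on each simplex shows that J
  can be kept for all points near x.\<close>

lemma continuous_map_prod_realisation:
  assumes h: "\<And>\<sigma>. \<sigma> \<in> K \<Longrightarrow>
      continuous_map (prod_topology (top_of_set {0..1}) (top_of_set (geometric_simplex \<sigma>))) Y h"
  shows "continuous_map (prod_topology (top_of_set {0..1::real}) (geometric_realisation K)) Y h"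
    (is "continuous_map ?P Y h")
  unfolding continuous_map_def
proof (intro conjI allI impI)
  show "h \<in> topspace ?P \<rightarrow> topspace Y"
    using h by (fastforce simp: continuous_map_def)
  fix U assume U: "openin Y U"
  let ?W = "{p \<in> topspace ?P. h p \<in> U}"
  show "openin ?P ?W"
    unfolding openin_prod_topology_alt
  proof (intro allI impI)
    fix t x assume tx: "(t, x) \<in> ?W"
    then obtain \<sigma> where \<sigma>: "\<sigma> \<in> K" "x \<in> geometric_simplex \<sigma>" and t: "t \<in> {0..1}" by auto
    have "continuous_map (top_of_set {0..1}) (prod_topology (top_of_set {0..1}) (top_of_set (geometric_simplex \<sigma>)))
            (\<lambda>s. (s, x))"
      using \<sigma> by (intro continuous_map_pairedI) auto
    from continuous_map_compose[OF this h[OF \<sigma>(1)]]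
    have "openin (top_of_set {0..1}) {s \<in> {0..1}. h (s, x) \<in> U}"
      using openin_continuous_map_preimage[OF _ U] by (fastforce simp: o_def)
    moreover have "t \<in> {s \<in> {0..1}. h (s, x) \<in> U}" using tx t by auto
    ultimately obtain e where e: "e > 0" "cball t e \<inter> {0..1} \<subseteq> {s \<in> {0..1}. h (s, x) \<in> U}"
      unfolding openin_contains_cball by blast
    define J where "J = cball t e \<inter> {0..1}"
    \<comment> \<open>V depends on no particular simplex, although the tubes that show it to be open
      are found in each simplex separately.\<close>
    define V where "V = {y \<in> topspace (geometric_realisation K). \<forall>s\<in>J. h (s, y) \<in> U}"
    have "compact J" unfolding J_def by (intro compact_Int) auto
    then have J: "compactin (top_of_set {0..1}) J"
      unfolding J_def by (auto simp: compactin_subtopology)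
    have "openin (top_of_set (geometric_simplex \<tau>)) (V \<inter> geometric_simplex \<tau>)" if \<tau>: "\<tau> \<in> K" for \<tau>
    proof (subst openin_subopen, intro ballI)
      fix y assume y: "y \<in> V \<inter> geometric_simplex \<tau>"
      let ?Q = "prod_topology (top_of_set {0..1}) (top_of_set (geometric_simplex \<tau>))"
      have W: "openin ?Q {p \<in> topspace ?Q. h p \<in> U}"
        by (rule openin_continuous_map_preimage[OF h[OF \<tau>] U])
      have "J \<times> {y} \<subseteq> {p \<in> topspace ?Q. h p \<in> U}"
        using y by (auto simp: V_def J_def)
      from tube_lemma_left[OF W J _ this] y obtain A B where AB:
        "openin (top_of_set (geometric_simplex \<tau>)) B" "J \<subseteq> A" "y \<in> B"
        "A \<times> B \<subseteq> {p \<in> topspace ?Q. h p \<in> U}"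
        by auto
      moreover have "B \<subseteq> geometric_simplex \<tau>"
        using AB(1) openin_imp_subset by blast
      ultimately have "B \<subseteq> V \<inter> geometric_simplex \<tau>"
        using \<tau> unfolding V_def by fastforce
      then show "\<exists>T. openin (top_of_set (geometric_simplex \<tau>)) T \<and> y \<in> T \<and> T \<subseteq> V \<inter> geometric_simplex \<tau>"
        using AB by blast
    qed
    then have "openin (geometric_realisation K) V"
      unfolding openin_geometric_realisation V_def by auto
    moreover have "openin (top_of_set {0..1}) (ball t e \<inter> {0..1})"
      using openin_open_Int[OF open_ball, of "{0..1}" t e] by (simp add: Int_commute)
    moreover have "x \<in> V" using e \<sigma> by (auto simp: V_def J_def)
    moreover have "(ball t e \<inter> {0..1}) \<times> V \<subseteq> ?W"
      using ball_subset_cball unfolding V_def J_def by fastforce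
    moreover have "t \<in> ball t e \<inter> {0..1}" using t e by simp
    ultimately show "\<exists>A B. openin (top_of_set {0..1}) A \<and> openin (geometric_realisation K) B \<and>
        t \<in> A \<and> x \<in> B \<and> A \<times> B \<subseteq> ?W"
      by blast
  qed
qed

text \<open>Lay the vertices of a chain out along \<open>[0, 1]\<close> in increasing order, each \<open>v\<close> occupying an
  interval of length \<open>x v\<close>.  At time \<open>t\<close> the map \<open>f\<close> is applied to the part below \<open>t\<close> and \<open>g\<close> to the
  rest.  Since \<open>f \<le> g\<close>, the vertices that occur form a chain.\<close>

definition mass_below :: "('v \<times> 'v) set \<Rightarrow> ('v \<Rightarrow> real) \<Rightarrow> 'v \<Rightarrow> real" where
  "mass_below r x v = (\<Sum>u | u \<in> support x \<and> (u, v) \<in> r \<and> u \<noteq> v. x u)"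

definition lower_part :: "('v \<times> 'v) set \<Rightarrow> real \<Rightarrow> ('v \<Rightarrow> real) \<Rightarrow> 'v \<Rightarrow> real" where
  "lower_part r t x v = max 0 (min (x v) (t - mass_below r x v))"

definition sliding_map ::
    "('v \<times> 'v) set \<Rightarrow> ('v \<Rightarrow> 'w) \<Rightarrow> ('v \<Rightarrow> 'w) \<Rightarrow> real \<Rightarrow> ('v \<Rightarrow> real) \<Rightarrow> 'w \<Rightarrow> real" where
  "sliding_map r f g t x w =
     affine_extension f (lower_part r t x) w + affine_extension g (\<lambda>v. x v - lower_part r t x v) w"

lemma affine_extension_outside:
  assumes "w \<notin> \<phi> ` support y" shows "affine_extension \<phi> y w = 0"
  unfolding affine_extension_def using assms by (intro sum.neutral) (auto simp: support_def)

lemma sum_affine_extension: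
  assumes "finite \<sigma>" "support y \<subseteq> \<sigma>" "finite \<tau>" "\<phi> ` support y \<subseteq> \<tau>"
  shows "(\<Sum>w\<in>\<tau>. affine_extension \<phi> y w) = sum y \<sigma>"
proof -
  have fin: "finite (support y)" using assms finite_subset by blast
  have "(\<Sum>w\<in>\<tau>. affine_extension \<phi> y w) = (\<Sum>w\<in>\<tau>. \<Sum>v | v \<in> support y \<and> \<phi> v = w. y v)"
    using affine_extension_eq_sum[OF fin order_refl] by (intro sum.cong) auto
  also have "\<dots> = sum y (support y)"
    by (rule sum.group) (use assms fin in auto)
  also have "\<dots> = sum y \<sigma>"
    using assms by (intro sum.mono_neutral_left) (auto simp: support_def)
  finally show ?thesis .
qed

section \<open>Homotopy between comparable monotone maps\<close>

context
  fixes r :: "('v \<times> 'v) set" and s :: "('w \<times> 'w) set" and f g :: "'v \<Rightarrow> 'w"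
  assumes r: "antisym r" "trans r" and s: "trans s"
    and f: "\<And>u v. (u, v) \<in> r \<Longrightarrow> (f u, f v) \<in> s" and g: "\<And>u v. (u, v) \<in> r \<Longrightarrow> (g u, g v) \<in> s"
    and fg: "\<And>v. v \<in> Field r \<Longrightarrow> (f v, g v) \<in> s"
begin

lemma mass_below_eq:
  assumes "\<sigma> \<in> order_complex r" "x \<in> geometric_simplex \<sigma>"
  shows "mass_below r x v = (\<Sum>u | u \<in> \<sigma> \<and> (u, v) \<in> r \<and> u \<noteq> v. x u)"
  unfolding mass_below_def
  using order_complex_finite[OF assms(1)] geometric_simplexD(4)[OF assms(2)]
  by (intro sum.mono_neutral_left) (auto simp: support_def)

lemma mass_below_nonneg: "x \<in> geometric_simplex \<sigma> \<Longrightarrow> 0 \<le> mass_below r x v"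
  unfolding mass_below_def by (intro sum_nonneg geometric_simplexD(1))

lemma mass_below_le:
  assumes \<sigma>: "\<sigma> \<in> order_complex r" and x: "x \<in> geometric_simplex \<sigma>" and "v \<in> \<sigma>"
  shows "mass_below r x v + x v \<le> 1"
proof -
  have fin: "finite \<sigma>" using order_complex_finite[OF \<sigma>] .
  have "mass_below r x v + x v = sum x (insert v {u. u \<in> \<sigma> \<and> (u, v) \<in> r \<and> u \<noteq> v})"
    unfolding mass_below_eq[OF \<sigma> x] using fin by (subst sum.insert) auto
  also have "\<dots> \<le> sum x \<sigma>"
    using fin \<open>v \<in> \<sigma>\<close> geometric_simplexD(1)[OF x] by (intro sum_mono2) auto
  finally show ?thesis using geometric_simplexD(3)[OF x] by simp
qed

text \<open>The intervals of different vertices do not overlap. By transitivity whatever lies below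
  u lies below v, and by antisymmetry it cannot be v itself.\<close>

lemma mass_below_mono:
  assumes \<sigma>: "\<sigma> \<in> order_complex r" and x: "x \<in> geometric_simplex \<sigma>"
    and uv: "u \<in> \<sigma>" "(u, v) \<in> r" "u \<noteq> v"
  shows "mass_below r x u + x u \<le> mass_below r x v"
proof -
  have fin: "finite \<sigma>" using order_complex_finite[OF \<sigma>] .
  have "mass_below r x u + x u = sum x (insert u {w. w \<in> \<sigma> \<and> (w, u) \<in> r \<and> w \<noteq> u})"
    unfolding mass_below_eq[OF \<sigma> x] using fin by (subst sum.insert) auto
  also have "\<dots> \<le> (\<Sum>w | w \<in> \<sigma> \<and> (w, v) \<in> r \<and> w \<noteq> v. x w)"
    using fin uv geometric_simplexD(1)[OF x] transD[OF r(2)] antisymD[OF r(1)]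
    by (intro sum_mono2) auto
  finally show ?thesis unfolding mass_below_eq[OF \<sigma> x] .
qed

lemma lower_part_bounds:
  assumes "x \<in> geometric_simplex \<sigma>"
  shows "0 \<le> lower_part r t x v" "lower_part r t x v \<le> x v"
  using geometric_simplexD(1)[OF assms, of v] by (auto simp: lower_part_def)

lemma lower_part_0:
  assumes "x \<in> geometric_simplex \<sigma>" shows "lower_part r 0 x = (\<lambda>v. 0)"
proof
  show "lower_part r 0 x v = 0" for v
    using mass_below_nonneg[OF assms, of v] by (simp add: lower_part_def)
qed

lemma lower_part_1:
  assumes "\<sigma> \<in> order_complex r" "x \<in> geometric_simplex \<sigma>"
  shows "lower_part r 1 x = x"
proof
  show "lower_part r 1 x v = x v" for v
  proof (cases "v \<in> \<sigma>")
    case True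
    then show ?thesis
      using mass_below_le[OF assms] geometric_simplexD(1)[OF assms(2), of v] by (force simp: lower_part_def)
  next
    case False
    then show ?thesis
      using geometric_simplexD(2)[OF assms(2)] by (auto simp: lower_part_def)
  qed
qed

text \<open>Only the comparison of some f v with some g u needs an argument: if both occur at time
  t, then v \<le> u, hence f v \<le> f u \<le> g u. The bound on \<tau> leaves finitely many
  candidates, as \<open>continuous_map_into_realisation\<close> requires.\<close>

lemma sliding_map_in_simplex:
  assumes \<sigma>: "\<sigma> \<in> order_complex r" and x: "x \<in> geometric_simplex \<sigma>"
  shows "\<exists>\<tau>\<in>order_complex s. \<tau> \<subseteq> f ` \<sigma> \<union> g ` \<sigma> \<and> sliding_map r f g t x \<in> geometric_simplex \<tau>"
proof -
  have fin: "finite \<sigma>" using order_complex_finite[OF \<sigma>] .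
  define y where "y = lower_part r t x"
  define z where "z = (\<lambda>v. x v - y v)"
  note xD = geometric_simplexD[OF x]
  have y: "0 \<le> y v" and z: "0 \<le> z v" for v
    using lower_part_bounds[OF x] by (auto simp: y_def z_def)
  have sy: "support y \<subseteq> \<sigma>" and sz: "support z \<subseteq> \<sigma>"
    using y z xD(2) by (force simp: support_def z_def lower_part_def y_def)+
  have finite_supp: "finite (support y)" "finite (support z)"
    using sy sz fin finite_subset by auto
  define \<tau> where "\<tau> = f ` support y \<union> g ` support z"
  have "(f v, g u) \<in> s" if v: "v \<in> support y" and u: "u \<in> support z" for u v
  proof -
    \<comment> \<open>The interval of v starts before t and that of u ends after t, so u cannot
      strictly precede v.\<close>
    have "mass_below r x v < t" using v by (auto simp: y_def support_def lower_part_def max_def min_def split: if_splits)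
    moreover have "t < mass_below r x u + x u"
      using u xD(1)[of u] by (auto simp: z_def y_def support_def lower_part_def max_def min_def split: if_splits)
    ultimately have "\<not> ((u, v) \<in> r \<and> u \<noteq> v)"
      using mass_below_mono[OF \<sigma> x, of u v] u sz by auto
    then have "(v, u) \<in> r"
      using order_complex_total[OF \<sigma>, of u v] u v sy sz by auto
    then have "(f v, f u) \<in> s" "(f u, g u) \<in> s"
      using f fg u sz order_complex_Field[OF \<sigma>] by auto
    then show ?thesis using transD[OF s] by blast
  qed
  moreover have "(f u, f v) \<in> s \<or> (f v, f u) \<in> s" if "u \<in> support y" "v \<in> support y" for u v
    using that sy f order_complex_total[OF \<sigma>, of u v] by blast
  moreover have "(g u, g v) \<in> s \<or> (g v, g u) \<in> s" if "u \<in> support z" "v \<in> support z" for u v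
    using that sz g order_complex_total[OF \<sigma>, of u v] by blast
  ultimately have "\<tau> \<in> Chains s"
    unfolding Chains_def \<tau>_def by blast
  moreover have "support x \<subseteq> support y \<union> support z" by (auto simp: support_def z_def)
  then have "\<tau> \<noteq> {}" using support_nonempty[OF x] by (auto simp: \<tau>_def)
  ultimately have \<tau>: "\<tau> \<in> order_complex s"
    using finite_supp by (simp add: order_complex_def \<tau>_def)
  have eq: "sliding_map r f g t x = (\<lambda>w. affine_extension f y w + affine_extension g z w)"
    by (simp add: sliding_map_def y_def z_def fun_eq_iff)
  have "finite \<tau>" using finite_supp by (simp add: \<tau>_def)
  then have "(\<Sum>w\<in>\<tau>. affine_extension f y w + affine_extension g z w) = sum y \<sigma> + sum z \<sigma>"
    using sum_affine_extension[OF fin sy \<open>finite \<tau>\<close>, of f]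
      sum_affine_extension[OF fin sz \<open>finite \<tau>\<close>, of g]
    by (simp add: sum.distrib \<tau>_def)
  also have "\<dots> = 1" using xD(3) by (simp add: z_def sum_subtractf)
  finally have "(\<Sum>w\<in>\<tau>. affine_extension f y w + affine_extension g z w) = 1" .
  moreover have "affine_extension f y w + affine_extension g z w = 0" if "w \<notin> \<tau>" for w
    using that affine_extension_outside by (simp add: \<tau>_def affine_extension_outside)
  moreover have "0 \<le> affine_extension f y w + affine_extension g z w" for w
    unfolding affine_extension_def using y z by (intro add_nonneg_nonneg sum_nonneg) auto
  ultimately have "sliding_map r f g t x \<in> geometric_simplex \<tau>"
    unfolding eq by (simp add: geometric_simplex_def)
  moreover have "\<tau> \<subseteq> f ` \<sigma> \<union> g ` \<sigma>" using sy sz by (auto simp: \<tau>_def)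
  ultimately show ?thesis using \<tau> by blast
qed

lemma continuous_on_sliding_map:
  assumes \<sigma>: "\<sigma> \<in> order_complex r"
  shows "continuous_on ({0..1} \<times> geometric_simplex \<sigma>) (\<lambda>p. sliding_map r f g (fst p) (snd p) w)"
proof -
  have fin: "finite \<sigma>" using order_complex_finite[OF \<sigma>] .
  have coord: "continuous_on S (\<lambda>p. snd p v)" for S :: "(real \<times> ('v \<Rightarrow> real)) set" and v
    by (rule continuous_on_compose2[OF continuous_on_product_coordinates continuous_on_snd[OF continuous_on_id]]) auto
  \<comment> \<open>The same as \<open>lower_part\<close> on this simplex, but summed over the fixed
    set \<sigma> in place of the varying support; in this form continuity is evident.\<close>
  define low where "low p v = max 0 (min (snd p v) (fst p - (\<Sum>u | u \<in> \<sigma> \<and> (u, v) \<in> r \<and> u \<noteq> v. snd p u)))"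
    for p :: "real \<times> ('v \<Rightarrow> real)" and v
  have low: "continuous_on S (\<lambda>p. low p v)" for S v
    unfolding low_def by (intro continuous_intros coord)
  have "continuous_on ({0..1} \<times> geometric_simplex \<sigma>)
      (\<lambda>p. (\<Sum>v | v \<in> \<sigma> \<and> f v = w. low p v) + (\<Sum>v | v \<in> \<sigma> \<and> g v = w. snd p v - low p v))"
    by (intro continuous_intros coord low)
  then show ?thesis
  proof (rule continuous_on_eq)
    fix p assume "p \<in> {0..1::real} \<times> geometric_simplex \<sigma>"
    then have x: "snd p \<in> geometric_simplex \<sigma>" by auto
    have l: "lower_part r (fst p) (snd p) = low p"
      by (simp add: fun_eq_iff lower_part_def low_def mass_below_eq[OF \<sigma> x])
    have "0 \<le> low p v \<and> low p v \<le> snd p v" for v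
      using lower_part_bounds[OF x] l by metis
    then have "support (low p) \<subseteq> \<sigma>" "support (\<lambda>v. snd p v - low p v) \<subseteq> \<sigma>"
      using geometric_simplexD(2)[OF x] unfolding support_def by (force intro: order_antisym)+
    then show "(\<Sum>v | v \<in> \<sigma> \<and> f v = w. low p v) + (\<Sum>v | v \<in> \<sigma> \<and> g v = w. snd p v - low p v)
        = sliding_map r f g (fst p) (snd p) w"
      by (simp add: sliding_map_def l affine_extension_eq_sum[OF fin])
  qed
qed

lemma homotopic_affine_extensions:
  "homotopic_with (\<lambda>_. True) (geometric_realisation (order_complex r))
     (geometric_realisation (order_complex s)) (affine_extension g) (affine_extension f)"
proof -
  let ?h = "\<lambda>p. sliding_map r f g (fst p) (snd p)"
  have "continuous_map (prod_topology (top_of_set {0..1}) (geometric_realisation (order_complex r)))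
      (geometric_realisation (order_complex s)) ?h"
  proof (rule continuous_map_prod_realisation)
    fix \<sigma> assume \<sigma>: "\<sigma> \<in> order_complex r"
    let ?T = "{\<tau> \<in> order_complex s. \<tau> \<subseteq> f ` \<sigma> \<union> g ` \<sigma>}"
    have "finite ?T" using order_complex_finite[OF \<sigma>] by simp
    moreover have "continuous_map (top_of_set ({0..1} \<times> geometric_simplex \<sigma>)) euclidean ?h"
      using continuous_on_sliding_map[OF \<sigma>] by (simp add: continuous_map_fun_componentwise)
    ultimately show "continuous_map
        (prod_topology (top_of_set {0..1}) (top_of_set (geometric_simplex \<sigma>)))
        (geometric_realisation (order_complex s)) ?h"
      using sliding_map_in_simplex[OF \<sigma>]
      by (intro continuous_map_into_realisation[where T="?T"]) (simp, blast, simp, fastforce)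
  qed
  moreover have "?h (0, x) = affine_extension g x" "?h (1, x) = affine_extension f x"
    if "x \<in> topspace (geometric_realisation (order_complex r))" for x
  proof -
    from that obtain \<sigma> where \<sigma>: "\<sigma> \<in> order_complex r" "x \<in> geometric_simplex \<sigma>" by auto
    show "?h (0, x) = affine_extension g x" "?h (1, x) = affine_extension f x"
      using lower_part_0[OF \<sigma>(2)] lower_part_1[OF \<sigma>]
      by (auto simp: sliding_map_def affine_extension_def)
  qed
  ultimately show ?thesis
    by (subst homotopic_with) (simp, intro exI[of _ ?h], simp)
qed

end

theorem contractible_realisation_join_semilattice:
  assumes refl: "refl_on (Field r) r" and r: "antisym r" "trans r"
    and joins: "\<And>a b. \<lbrakk>a \<in> Field r; b \<in> Field r\<rbrakk> \<Longrightarrow>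
      \<exists>j. (a, j) \<in> r \<and> (b, j) \<in> r \<and> (\<forall>c. (a, c) \<in> r \<and> (b, c) \<in> r \<longrightarrow> (j, c) \<in> r)"
  shows "contractible_space (geometric_realisation (order_complex r))"
proof (cases "Field r = {}")
  \<comment> \<open>An empty space counts as contractible here; for fixed point sets nonemptiness is
    proved separately.\<close>
  case True
  then have "order_complex r = {}"
    using order_complex_Field by (force simp: order_complex_def)
  then have "geometric_realisation (order_complex r) = trivial_topology"
    by (simp flip: null_topspace_iff_trivial)
  then show ?thesis by simp
next
  case False
  let ?X = "geometric_realisation (order_complex r)"
  from False obtain b where b: "b \<in> Field r" by blast
  from joins[OF _ b] obtain j where j: "\<And>a. a \<in> Field r \<Longrightarrow>
      (a, j a) \<in> r \<and> (b, j a) \<in> r \<and> (\<forall>c. (a, c) \<in> r \<and> (b, c) \<in> r \<longrightarrow> (j a, c) \<in> r)"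
    by metis
  \<comment> \<open>Here least upper bounds matter: j v bounds u and b from above, so it lies above
    their join j u. Arbitrary upper bounds would not give a monotone map.\<close>
  have mono: "(j u, j v) \<in> r" if "(u, v) \<in> r" for u v
  proof -
    have "u \<in> Field r" "v \<in> Field r" using that by (auto simp: Field_def)
    then show ?thesis using j that transD[OF r(2)] by blast
  qed
  have "homotopic_with (\<lambda>_. True) ?X ?X (affine_extension j) (affine_extension (\<lambda>v. v))"
    by (rule homotopic_affine_extensions) (use r mono j in auto)
  moreover have "homotopic_with (\<lambda>_. True) ?X ?X (affine_extension j) (affine_extension (\<lambda>v. b))"
    by (rule homotopic_affine_extensions) (use r mono j b refl in \<open>auto simp: refl_on_def\<close>)
  ultimately have "homotopic_with (\<lambda>_. True) ?X ?X (affine_extension (\<lambda>v. v)) (affine_extension (\<lambda>v. b))"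
    using homotopic_with_symD homotopic_with_trans by blast
  \<comment> \<open>All mass is collected at b, so the end of the homotopy is constant at that
    vertex.\<close>
  moreover have "affine_extension (\<lambda>v. b) x = (\<lambda>w. if w = b then 1 else 0)" if "x \<in> topspace ?X" for x
  proof
    fix w
    from that obtain \<sigma> where \<sigma>: "\<sigma> \<in> order_complex r" "x \<in> geometric_simplex \<sigma>" by auto
    show "affine_extension (\<lambda>v. b) x w = (if w = b then 1 else 0)"
      using affine_extension_eq_sum[OF order_complex_finite[OF \<sigma>(1)] geometric_simplexD(4)[OF \<sigma>(2)], of "\<lambda>v. b" w]
        geometric_simplexD(3)[OF \<sigma>(2)] by simp
  qed
  ultimately have "homotopic_with (\<lambda>_. True) ?X ?X id (\<lambda>x w. if w = b then 1 else 0)"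
    by (subst (asm) homotopic_with, simp, subst homotopic_with) (auto simp: affine_extension_id)
  then show ?thesis unfolding contractible_space_def by blast
qed

section \<open>Injections, shifts and joins\<close>

definition multi_shift :: "nat \<Rightarrow> (nat \<Rightarrow> nat) \<Rightarrow> point \<Rightarrow> point" where
  "multi_shift n a = (\<lambda>(i, x)\<in>rays n. (i + a x, x))"

lemma mem_rays [simp]: "(i, x) \<in> rays n \<longleftrightarrow> x \<in> {1..n}"
  by (auto simp: rays_def)

lemma eventually_translationI:
  assumes "\<And>x. x \<in> {1..n} \<Longrightarrow> \<exists>m z. \<forall>i\<ge>z. int (fst (h (i, x))) = int i + m \<and> snd (h (i, x)) = x"
  shows "eventually_translation n h"
proof -
  from assms have "\<forall>x\<in>{1..n}. \<exists>m z. \<forall>i\<ge>z. int (fst (h (i, x))) = int i + m \<and> snd (h (i, x)) = x"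
    by blast
  then show ?thesis
    unfolding eventually_translation_def by metis
qed

lemma eventually_translationE:
  assumes "eventually_translation n h"
  obtains z m where "\<And>x i. \<lbrakk>x \<in> {1..n}; z x \<le> i\<rbrakk> \<Longrightarrow> 0 \<le> int i + m x \<and> h (i, x) = (nat (int i + m x), x)"
proof -
  from assms obtain z m where
    zm: "\<forall>x\<in>{1..n}. \<forall>i\<ge>z x. int (fst (h (i, x))) = int i + m x \<and> snd (h (i, x)) = x"
    unfolding eventually_translation_def by blast
  show ?thesis
  proof (rule that[of z m])
    fix x i assume "x \<in> {1..n}" "z x \<le> i"
    then have "int (fst (h (i, x))) = int i + m x" "snd (h (i, x)) = x"
      using zm by auto
    then show "0 \<le> int i + m x \<and> h (i, x) = (nat (int i + m x), x)"
      by (metis nat_int of_nat_0_le_iff prod.collapse)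
  qed
qed

lemma eventually_translation_compose:
  assumes h: "eventually_translation n h" and k: "eventually_translation n k"
  shows "eventually_translation n (compose (rays n) k h)"
proof -
  obtain z m where h: "\<And>x i. \<lbrakk>x \<in> {1..n}; z x \<le> i\<rbrakk> \<Longrightarrow> 0 \<le> int i + m x \<and> h (i, x) = (nat (int i + m x), x)"
    using eventually_translationE[OF h] by metis
  obtain z' m' where k: "\<And>x i. \<lbrakk>x \<in> {1..n}; z' x \<le> i\<rbrakk> \<Longrightarrow> 0 \<le> int i + m' x \<and> k (i, x) = (nat (int i + m' x), x)"
    using eventually_translationE[OF k] by metis
  show ?thesis
  proof (rule eventually_translationI)
    fix x assume x: "x \<in> {1..n}"
    \<comment> \<open>The bound puts i in the range where h translates, and i + m x in the range
      where k does.\<close>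
    have "int (fst (compose (rays n) k h (i, x))) = int i + (m x + m' x) \<and>
        snd (compose (rays n) k h (i, x)) = x" if "i \<ge> max (z x) (nat (int (z' x) - m x))" for i
    proof -
      have "0 \<le> int i + m x" "h (i, x) = (nat (int i + m x), x)"
        using h[OF x, of i] that by auto
      moreover have "z' x \<le> nat (int i + m x)" using that by linarith
      ultimately show ?thesis
        using k[OF x, of "nat (int i + m x)"] x by (simp add: compose_def)
    qed
    then show "\<exists>m z. \<forall>i\<ge>z. int (fst (compose (rays n) k h (i, x))) = int i + m \<and>
        snd (compose (rays n) k h (i, x)) = x"
      by blast
  qed
qed

lemma eventually_translation_inv:
  assumes bij: "bij_betw h (rays n) (rays n)" and h: "eventually_translation n h"
  shows "eventually_translation n (\<lambda>p\<in>rays n. inv_into (rays n) h p)"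
proof -
  obtain z m where h: "\<And>x i. \<lbrakk>x \<in> {1..n}; z x \<le> i\<rbrakk> \<Longrightarrow> 0 \<le> int i + m x \<and> h (i, x) = (nat (int i + m x), x)"
    using eventually_translationE[OF h] by metis
  show ?thesis
  proof (rule eventually_translationI)
    fix x assume x: "x \<in> {1..n}"
    \<comment> \<open>Past z + m the candidate preimage i - m is at least z, where h is known to
      translate.\<close>
    have "int (fst (inv_into (rays n) h (i, x))) = int i + (- m x) \<and>
        snd (inv_into (rays n) h (i, x)) = x" if "i \<ge> nat (int (z x) + m x)" for i
    proof -
      have i: "int i - m x \<ge> int (z x)" using that by linarith
      then have "h (nat (int i - m x), x) = (i, x)"
        using h[OF x, of "nat (int i - m x)"] by simp
      then have "inv_into (rays n) h (i, x) = (nat (int i - m x), x)"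
        using bij_betw_inv_into_left[OF bij, of "(nat (int i - m x), x)"] x by simp
      then show ?thesis using i by simp
    qed
    then show "\<exists>m z. \<forall>i\<ge>z. int (fst ((\<lambda>p\<in>rays n. inv_into (rays n) h p) (i, x))) = int i + m \<and>
        snd ((\<lambda>p\<in>rays n. inv_into (rays n) h p) (i, x)) = x"
      using x by (intro exI[of _ "- m x"] exI[of _ "nat (int (z x) + m x)"]) simp
  qed
qed

lemma mem_injection_monoid:
  "h \<in> carrier (injection_monoid n) \<longleftrightarrow>
     h \<in> rays n \<rightarrow>\<^sub>E rays n \<and> inj_on h (rays n) \<and> eventually_translation n h"
  by (simp add: injection_monoid_def)

lemma mem_houghton_group:
  "h \<in> carrier (houghton_group n) \<longleftrightarrow>
     h \<in> carrier (injection_monoid n) \<and> h ` rays n = rays n"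
  by (auto simp: houghton_group_def injection_monoid_def Bij_def bij_betw_def PiE_def)

lemma injection_monoid_mult [simp]: "\<alpha> \<otimes>\<^bsub>injection_monoid n\<^esub> \<beta> = compose (rays n) \<beta> \<alpha>"
  and injection_monoid_one [simp]: "\<one>\<^bsub>injection_monoid n\<^esub> = (\<lambda>p\<in>rays n. p)"
  and houghton_group_mult [simp]: "\<alpha> \<otimes>\<^bsub>houghton_group n\<^esub> \<beta> = compose (rays n) \<beta> \<alpha>"
  and houghton_group_one [simp]: "\<one>\<^bsub>houghton_group n\<^esub> = (\<lambda>p\<in>rays n. p)"
  by (simp_all add: injection_monoid_def houghton_group_def)

lemma injection_monoid_compose:
  assumes "\<alpha> \<in> carrier (injection_monoid n)" "\<beta> \<in> carrier (injection_monoid n)"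
  shows "compose (rays n) \<beta> \<alpha> \<in> carrier (injection_monoid n)"
proof -
  have \<alpha>: "\<alpha> \<in> rays n \<rightarrow> rays n" and \<beta>: "\<beta> \<in> rays n \<rightarrow> rays n"
    using assms by (auto simp: mem_injection_monoid)
  have "inj_on (\<beta> \<circ> \<alpha>) (rays n)"
    using assms \<alpha> by (intro comp_inj_on) (auto simp: mem_injection_monoid intro: inj_on_subset)
  then have "inj_on (compose (rays n) \<beta> \<alpha>) (rays n)"
    by (simp add: compose_def inj_on_def)
  moreover have "compose (rays n) \<beta> \<alpha> \<in> rays n \<rightarrow>\<^sub>E rays n"
    using funcset_compose[OF \<alpha> \<beta>] by (simp add: PiE_def)
  ultimately show ?thesis
    using assms eventually_translation_compose by (simp add: mem_injection_monoid)
qed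

lemma injection_monoid_ext:
  assumes "\<alpha> \<in> carrier (injection_monoid n)" "\<beta> \<in> carrier (injection_monoid n)"
    "\<And>i x. x \<in> {1..n} \<Longrightarrow> \<alpha> (i, x) = \<beta> (i, x)"
  shows "\<alpha> = \<beta>"
proof (rule extensionalityI[where A="rays n"])
  show "\<alpha> p = \<beta> p" if "p \<in> rays n" for p
    using assms(3) that by (cases p) simp
qed (use assms in \<open>auto simp: mem_injection_monoid PiE_def\<close>)

lemma injection_monoid_mem_rays:
  assumes "\<alpha> \<in> carrier (injection_monoid n)" "p \<in> rays n" shows "\<alpha> p \<in> rays n"
  using assms by (auto simp: mem_injection_monoid)

lemma injection_monoid_inj:
  assumes "\<alpha> \<in> carrier (injection_monoid n)" "p \<in> rays n" "q \<in> rays n" "\<alpha> p = \<alpha> q" shows "p = q"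
  using assms by (auto simp: mem_injection_monoid inj_on_def)

lemma compose_assoc_rays:
  assumes "\<alpha> \<in> carrier (injection_monoid n)"
  shows "compose (rays n) (compose (rays n) \<gamma> \<beta>) \<alpha> = compose (rays n) \<gamma> (compose (rays n) \<beta> \<alpha>)"
  using assms by (intro compose_assoc[symmetric]) (auto simp: mem_injection_monoid)

lemma one_in_houghton_group: "(\<lambda>p\<in>rays n. p) \<in> carrier (houghton_group n)"
proof -
  have "eventually_translation n (\<lambda>p\<in>rays n. p)"
    by (rule eventually_translationI) (auto intro!: exI[of _ 0])
  then show ?thesis by (auto simp: mem_houghton_group mem_injection_monoid inj_on_def)
qed

lemma compose_one_right: "\<alpha> \<in> carrier (injection_monoid n) \<Longrightarrow> compose (rays n) (\<lambda>p\<in>rays n. p) \<alpha> = \<alpha>"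
  by (rule Id_compose) (auto simp: mem_injection_monoid PiE_def)

lemma group_houghton_group: "group (houghton_group n)"
proof (rule groupI; (unfold houghton_group_mult houghton_group_one)?)
  fix \<alpha> \<beta> assume "\<alpha> \<in> carrier (houghton_group n)" "\<beta> \<in> carrier (houghton_group n)"
  then show "compose (rays n) \<beta> \<alpha> \<in> carrier (houghton_group n)"
    using injection_monoid_compose surj_compose[where A="rays n" and B="rays n" and C="rays n"]
    by (simp add: mem_houghton_group)
next
  show "(\<lambda>p\<in>rays n. p) \<in> carrier (houghton_group n)"
    by (rule one_in_houghton_group)
next
  fix \<alpha> \<beta> \<gamma> assume "\<alpha> \<in> carrier (houghton_group n)"
  then show "compose (rays n) \<gamma> (compose (rays n) \<beta> \<alpha>) = compose (rays n) (compose (rays n) \<gamma> \<beta>) \<alpha>"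
    using compose_assoc_rays[of \<alpha> n \<gamma> \<beta>] by (simp only: mem_houghton_group)
next
  fix \<alpha> assume "\<alpha> \<in> carrier (houghton_group n)"
  then show "compose (rays n) \<alpha> (\<lambda>p\<in>rays n. p) = \<alpha>"
    by (intro compose_Id) (auto simp: mem_houghton_group mem_injection_monoid PiE_def)
next
  fix \<alpha> assume \<alpha>: "\<alpha> \<in> carrier (houghton_group n)"
  then have bij: "bij_betw \<alpha> (rays n) (rays n)"
    by (auto simp: mem_houghton_group mem_injection_monoid bij_betw_def)
  let ?i = "\<lambda>p\<in>rays n. inv_into (rays n) \<alpha> p"
  have bi: "bij_betw ?i (rays n) (rays n)"
    using bij_betw_inv_into[OF bij] by (simp cong: bij_betw_cong)
  have "?i \<in> carrier (houghton_group n)"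
    using eventually_translation_inv[OF bij] \<alpha> bi
    by (auto simp: mem_houghton_group mem_injection_monoid bij_betw_def)
  moreover have "compose (rays n) \<alpha> ?i = (\<lambda>p\<in>rays n. p)"
    using bij_betw_inv_into_right[OF bij] by (auto simp: compose_def fun_eq_iff)
  ultimately show "\<exists>\<beta>\<in>carrier (houghton_group n). compose (rays n) \<alpha> \<beta> = (\<lambda>p\<in>rays n. p)"
    by blast
qed

section \<open>Simultaneous shifts and the order they induce\<close>

lemma multi_shift_apply [simp]: "x \<in> {1..n} \<Longrightarrow> multi_shift n a (i, x) = (i + a x, x)"
  by (simp add: multi_shift_def)

lemma multi_shift_in_injection_monoid: "multi_shift n a \<in> carrier (injection_monoid n)"
proof -
  have "eventually_translation n (multi_shift n a)"
  proof (rule eventually_translationI)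
    show "\<exists>m z. \<forall>i\<ge>z. int (fst (multi_shift n a (i, x))) = int i + m \<and> snd (multi_shift n a (i, x)) = x"
      if "x \<in> {1..n}" for x
      using that by (intro exI[of _ "int (a x)"]) simp
  qed
  then show ?thesis
    by (auto simp: mem_injection_monoid multi_shift_def inj_on_def split: prod.splits)
qed

lemma multi_shift_add:
  "compose (rays n) (multi_shift n b) (multi_shift n a) = multi_shift n (\<lambda>x. a x + b x)"
  by (intro injection_monoid_ext[where n=n] injection_monoid_compose multi_shift_in_injection_monoid)
    (simp add: compose_def)

lemma multi_shift_zero: "multi_shift n (\<lambda>x. 0) = (\<lambda>p\<in>rays n. p)"
  by (auto simp: multi_shift_def fun_eq_iff)

lemma ray_shift_eq: "ray_shift n y = multi_shift n (\<lambda>x. if x = y then 1 else 0)"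
  by (auto simp: ray_shift_def multi_shift_def fun_eq_iff)

text \<open>Shifts commute, so a product of generators is determined by how often each one occurs.
  The induction is on the total shift over all rays, splitting off one generator at a time.\<close>

lemma translation_monoid_eq: "translation_monoid n = range (multi_shift n)"
proof
  have "submonoid (range (multi_shift n)) (injection_monoid n)"
    using multi_shift_in_injection_monoid multi_shift_zero[symmetric]
    by (intro submonoid.intro) (auto simp: multi_shift_add)
  moreover have "ray_shift n ` {1..n} \<subseteq> range (multi_shift n)"
    by (auto simp: ray_shift_eq)
  ultimately show "translation_monoid n \<subseteq> range (multi_shift n)"
    unfolding translation_monoid_def by (rule hull_minimal[rotated])
  have "multi_shift n a \<in> H" if H: "submonoid H (injection_monoid n)" "ray_shift n ` {1..n} \<subseteq> H" for H a
  proof (induction "\<Sum>x=1..n. a x" arbitrary: a)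
    case 0
    then have "multi_shift n a = multi_shift n (\<lambda>x. 0)"
      by (auto simp: multi_shift_def fun_eq_iff)
    then show ?case
      using submonoid.one_closed[OF H(1)] by (simp only: multi_shift_zero injection_monoid_one)
  next
    case (Suc k)
    then obtain y where y: "y \<in> {1..n}" "a y > 0"
      by (metis gr0I sum.neutral nat.distinct(1))
    define b where "b = a(y := a y - 1)"
    have a: "a = (\<lambda>x. b x + (if x = y then 1 else 0))"
      using y by (auto simp: b_def fun_eq_iff)
    have "sum a {1..n} = sum b {1..n} + 1"
      by (subst a) (use y in \<open>simp add: sum.distrib\<close>)
    then have "multi_shift n b \<in> H" using Suc by simp
    moreover have "ray_shift n y \<in> H" using H(2) y by auto
    ultimately have "multi_shift n b \<otimes>\<^bsub>injection_monoid n\<^esub> ray_shift n y \<in> H"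
      using submonoid.m_closed[OF H(1)] by blast
    moreover have "multi_shift n b \<otimes>\<^bsub>injection_monoid n\<^esub> ray_shift n y = multi_shift n a"
      using a by (simp add: ray_shift_eq multi_shift_add)
    ultimately show ?case by simp
  qed
  then show "range (multi_shift n) \<subseteq> translation_monoid n"
    by (auto simp: translation_monoid_def hull_def)
qed

lemma injection_order_iff:
  "(\<alpha>, \<beta>) \<in> injection_order n \<longleftrightarrow>
     \<alpha> \<in> carrier (injection_monoid n) \<and> (\<exists>a. \<beta> = compose (rays n) \<alpha> (multi_shift n a))"
  by (auto simp: injection_order_def translation_monoid_eq
      intro: injection_monoid_compose multi_shift_in_injection_monoid)

lemma injection_order_iff_apply:
  "(\<alpha>, \<beta>) \<in> injection_order n \<longleftrightarrow>
     \<alpha> \<in> carrier (injection_monoid n) \<and> \<beta> \<in> carrier (injection_monoid n) \<and>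
     (\<exists>a. \<forall>x\<in>{1..n}. \<forall>i. \<beta> (i, x) = \<alpha> (i + a x, x))"
proof
  assume "(\<alpha>, \<beta>) \<in> injection_order n"
  then obtain a where \<alpha>: "\<alpha> \<in> carrier (injection_monoid n)" and \<beta>: "\<beta> = compose (rays n) \<alpha> (multi_shift n a)"
    unfolding injection_order_iff by blast
  have "\<beta> \<in> carrier (injection_monoid n)"
    unfolding \<beta> by (intro injection_monoid_compose multi_shift_in_injection_monoid \<alpha>)
  moreover have "\<forall>x\<in>{1..n}. \<forall>i. \<beta> (i, x) = \<alpha> (i + a x, x)"
    unfolding \<beta> by (simp add: compose_eq)
  ultimately show "\<alpha> \<in> carrier (injection_monoid n) \<and> \<beta> \<in> carrier (injection_monoid n) \<and>
     (\<exists>a. \<forall>x\<in>{1..n}. \<forall>i. \<beta> (i, x) = \<alpha> (i + a x, x))"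
    using \<alpha> by blast
next
  assume *: "\<alpha> \<in> carrier (injection_monoid n) \<and> \<beta> \<in> carrier (injection_monoid n) \<and>
     (\<exists>a. \<forall>x\<in>{1..n}. \<forall>i. \<beta> (i, x) = \<alpha> (i + a x, x))"
  then obtain a where "\<forall>x\<in>{1..n}. \<forall>i. \<beta> (i, x) = \<alpha> (i + a x, x)" by blast
  with * have "\<beta> = compose (rays n) \<alpha> (multi_shift n a)"
    by (intro injection_monoid_ext[where n=n] injection_monoid_compose multi_shift_in_injection_monoid)
      (auto simp: compose_eq)
  with * show "(\<alpha>, \<beta>) \<in> injection_order n"
    unfolding injection_order_iff by blast
qed

lemma injection_order_refl:
  assumes "\<alpha> \<in> carrier (injection_monoid n)" shows "(\<alpha>, \<alpha>) \<in> injection_order n"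
  using assms unfolding injection_order_iff_apply by (auto intro!: exI[of _ "\<lambda>x. 0"])

lemma Field_injection_order: "Field (injection_order n) = carrier (injection_monoid n)"
proof
  show "Field (injection_order n) \<subseteq> carrier (injection_monoid n)"
    by (auto simp: Field_def injection_order_iff_apply)
qed (use injection_order_refl in \<open>blast intro: FieldI1\<close>)

lemma trans_injection_order: "trans (injection_order n)"
proof (rule transI)
  fix \<alpha> \<beta> \<gamma> assume "(\<alpha>, \<beta>) \<in> injection_order n" "(\<beta>, \<gamma>) \<in> injection_order n"
  then obtain a b where
    "\<alpha> \<in> carrier (injection_monoid n)" "\<gamma> \<in> carrier (injection_monoid n)"
    "\<forall>x\<in>{1..n}. \<forall>i. \<beta> (i, x) = \<alpha> (i + a x, x)" "\<forall>x\<in>{1..n}. \<forall>i. \<gamma> (i, x) = \<beta> (i + b x, x)"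
    unfolding injection_order_iff_apply by blast
  then show "(\<alpha>, \<gamma>) \<in> injection_order n"
    by (auto simp: injection_order_iff_apply add.assoc intro!: exI[of _ "\<lambda>x. b x + a x"])
qed

text \<open>Going up to \<beta> and back shifts the ray x by b x + a x without changing \<alpha>; as
  \<alpha> is injective, this total must be 0.\<close>

lemma antisym_injection_order: "antisym (injection_order n)"
proof (rule antisymI)
  fix \<alpha> \<beta> assume "(\<alpha>, \<beta>) \<in> injection_order n" "(\<beta>, \<alpha>) \<in> injection_order n"
  then obtain a b where \<alpha>: "\<alpha> \<in> carrier (injection_monoid n)" and \<beta>: "\<beta> \<in> carrier (injection_monoid n)"
    and a: "\<And>x i. x\<in>{1..n} \<Longrightarrow> \<beta> (i, x) = \<alpha> (i + a x, x)" and b: "\<And>x i. x\<in>{1..n} \<Longrightarrow> \<alpha> (i, x) = \<beta> (i + b x, x)"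
    unfolding injection_order_iff_apply by blast
  have "a x = 0" if x: "x \<in> {1..n}" for x
  proof -
    have "\<alpha> (0, x) = \<alpha> (b x + a x, x)" using a[OF x] b[OF x, of 0] by simp
    then show ?thesis using injection_monoid_inj[OF \<alpha>, of "(0, x)" "(b x + a x, x)"] x by simp
  qed
  then show "\<alpha> = \<beta>"
    using a by (intro injection_monoid_ext[OF \<alpha> \<beta>]) simp
qed

text \<open>Shifts are applied before \<alpha> and \<gamma> after it, so the same shift serves for
  the composites.\<close>

lemma injection_order_mult:
  assumes "(\<alpha>, \<beta>) \<in> injection_order n" "\<gamma> \<in> carrier (injection_monoid n)"
  shows "(compose (rays n) \<gamma> \<alpha>, compose (rays n) \<gamma> \<beta>) \<in> injection_order n"
  using assms by (auto simp: injection_order_iff_apply compose_def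
      intro: injection_monoid_compose[unfolded compose_def])

text \<open>The common upper bounds of \<open>\<alpha>\<close> and \<open>\<beta>\<close> can be found one ray at a time: far out on a ray both
  maps are translations, so some shift of \<open>\<alpha>\<close> agrees with a shift of \<open>\<beta>\<close>, and the least such
  shift gives the join.\<close>

lemma common_shift_exists:
  assumes \<alpha>: "\<alpha> \<in> carrier (injection_monoid n)" and \<beta>: "\<beta> \<in> carrier (injection_monoid n)"
    and x: "x \<in> {1..n}"
  shows "\<exists>a b. \<forall>i. \<alpha> (i + a, x) = \<beta> (i + b, x)"
proof -
  obtain z m where a: "\<And>x i. \<lbrakk>x \<in> {1..n}; z x \<le> i\<rbrakk> \<Longrightarrow> 0 \<le> int i + m x \<and> \<alpha> (i, x) = (nat (int i + m x), x)"
    using \<alpha> eventually_translationE by (metis mem_injection_monoid)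
  obtain z' m' where b: "\<And>x i. \<lbrakk>x \<in> {1..n}; z' x \<le> i\<rbrakk> \<Longrightarrow> 0 \<le> int i + m' x \<and> \<beta> (i, x) = (nat (int i + m' x), x)"
    using \<beta> eventually_translationE by (metis mem_injection_monoid)
  \<comment> \<open>k is the common value of m x + p and m' x + q. It is so large that p and q are
    not truncated by \<open>nat\<close> and exceed or equal both thresholds.\<close>
  define k where "k = \<bar>m x\<bar> + \<bar>m' x\<bar> + int (z x) + int (z' x)"
  define p where "p = nat (k - m x)"
  define q where "q = nat (k - m' x)"
  have "\<alpha> (i + p, x) = \<beta> (i + q, x)" for i
  proof -
    have "int (i + p) + m x = int (i + q) + m' x" "z x \<le> i + p" "z' x \<le> i + q"
      by (auto simp: p_def q_def k_def)
    then show ?thesis using a[OF x, of "i + p"] b[OF x, of "i + q"] by simp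
  qed
  then show ?thesis by blast
qed

lemma injection_order_join:
  assumes \<alpha>: "\<alpha> \<in> carrier (injection_monoid n)" and \<beta>: "\<beta> \<in> carrier (injection_monoid n)"
  shows "\<exists>\<gamma>. (\<alpha>, \<gamma>) \<in> injection_order n \<and> (\<beta>, \<gamma>) \<in> injection_order n \<and>
    (\<forall>\<delta>. (\<alpha>, \<delta>) \<in> injection_order n \<and> (\<beta>, \<delta>) \<in> injection_order n \<longrightarrow> (\<gamma>, \<delta>) \<in> injection_order n)"
proof -
  define P where "P x p \<longleftrightarrow> (\<exists>q. \<forall>i. \<alpha> (i + p, x) = \<beta> (i + q, x))" for x p
  define a where "a x = (LEAST p. P x p)" for x
  have P: "P x (a x)" if "x \<in> {1..n}" for x
  proof -
    have "\<exists>p. P x p" unfolding P_def by (rule common_shift_exists[OF \<alpha> \<beta> that])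
    then show ?thesis unfolding a_def by (rule LeastI_ex)
  qed
  then obtain b where b: "\<And>x i. x \<in> {1..n} \<Longrightarrow> \<alpha> (i + a x, x) = \<beta> (i + b x, x)"
    unfolding P_def by metis
  define \<gamma> where "\<gamma> = compose (rays n) \<alpha> (multi_shift n a)"
  have \<gamma>_mem: "\<gamma> \<in> carrier (injection_monoid n)"
    unfolding \<gamma>_def by (intro injection_monoid_compose multi_shift_in_injection_monoid \<alpha>)
  have \<gamma>: "\<gamma> (i, x) = \<alpha> (i + a x, x)" if "x \<in> {1..n}" for i x
    using that by (simp add: \<gamma>_def compose_def)
  have "\<forall>x\<in>{1..n}. \<forall>i. \<gamma> (i, x) = \<beta> (i + b x, x)"
    using \<gamma> b by metis
  then have "(\<alpha>, \<gamma>) \<in> injection_order n" "(\<beta>, \<gamma>) \<in> injection_order n"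
    unfolding injection_order_iff_apply using \<alpha> \<beta> \<gamma> \<gamma>_mem by blast+
  moreover have "(\<gamma>, \<delta>) \<in> injection_order n"
    if "(\<alpha>, \<delta>) \<in> injection_order n" "(\<beta>, \<delta>) \<in> injection_order n" for \<delta>
  proof -
    from that obtain c d where \<delta>: "\<delta> \<in> carrier (injection_monoid n)"
      and c: "\<And>x i. x \<in> {1..n} \<Longrightarrow> \<delta> (i, x) = \<alpha> (i + c x, x)" and d: "\<And>x i. x \<in> {1..n} \<Longrightarrow> \<delta> (i, x) = \<beta> (i + d x, x)"
      unfolding injection_order_iff_apply by blast
    \<comment> \<open>A common upper bound makes c x a competitor for the least shift; consequently
      the natural subtraction c x - a x below is exact.\<close>
    have ac: "a x \<le> c x" if "x \<in> {1..n}" for x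
      unfolding a_def P_def
      by (rule Least_le, rule exI[of _ "d x"]) (use c[OF that] d[OF that] in simp)
    have "\<delta> (i, x) = \<gamma> (i + (c x - a x), x)" if "x \<in> {1..n}" for i x
      unfolding c[OF that] \<gamma>[OF that] using ac[OF that] by simp
    then show ?thesis
      unfolding injection_order_iff_apply using \<gamma>_mem \<delta>
      by (intro conjI exI[of _ "\<lambda>x. c x - a x"]) simp_all
  qed
  ultimately show ?thesis by blast
qed

text \<open>Each ray is covered from some point on, because \<alpha> translates its far end along
  itself.\<close>

lemma finite_complement_image:
  assumes \<alpha>: "\<alpha> \<in> carrier (injection_monoid n)"
  shows "finite (rays n - \<alpha> ` rays n)"
proof -
  obtain z m where a: "\<And>x i. \<lbrakk>x \<in> {1..n}; z x \<le> i\<rbrakk> \<Longrightarrow> 0 \<le> int i + m x \<and> \<alpha> (i, x) = (nat (int i + m x), x)"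
    using \<alpha> eventually_translationE by (metis mem_injection_monoid)
  have "rays n - \<alpha> ` rays n \<subseteq> (\<Union>x\<in>{1..n}. {..nat (int (z x) + m x)} \<times> {x})"
  proof (clarsimp)
    fix i x assume ix: "(i, x) \<notin> \<alpha> ` rays n" "Suc 0 \<le> x" "x \<le> n"
    show "i \<le> nat (int (z x) + m x)"
    proof (rule ccontr)
      assume "\<not> i \<le> nat (int (z x) + m x)"
      then have i: "int (z x) \<le> int i - m x" by linarith
      then have "\<alpha> (nat (int i - m x), x) = (i, x)"
        using a[of x "nat (int i - m x)"] ix by simp
      then show False using ix by (metis One_nat_def atLeastAtMost_iff image_eqI mem_rays)
    qed
  qed
  then show ?thesis by (rule finite_subset) auto
qed

lemma finite_stabiliser:
  assumes \<alpha>: "\<alpha> \<in> carrier (injection_monoid n)"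
  shows "finite {h \<in> carrier (houghton_group n). compose (rays n) h \<alpha> = \<alpha>}" (is "finite ?S")
proof -
  define F where "F = rays n - \<alpha> ` rays n"
  have fix_image: "h p = p" if "h \<in> ?S" "p \<in> \<alpha> ` rays n" for h p
  proof -
    from that obtain q where "q \<in> rays n" "p = \<alpha> q" by blast
    moreover have "compose (rays n) h \<alpha> q = \<alpha> q" using that by simp
    ultimately show ?thesis by (simp add: compose_def)
  qed
  have "(\<lambda>h. restrict h F) ` ?S \<subseteq> F \<rightarrow>\<^sub>E F"
  proof clarify
    fix h assume h: "h \<in> carrier (houghton_group n)" "compose (rays n) h \<alpha> = \<alpha>"
    then have hM: "h \<in> carrier (injection_monoid n)" by (simp add: mem_houghton_group)
    have "h p \<in> F" if p: "p \<in> F" for p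
    proof -
      have "h p \<in> rays n" using injection_monoid_mem_rays[OF hM] p by (simp add: F_def)
      \<comment> \<open>A point of the image is fixed by h, so if h moved p there, h p and p would
        have the same image under the injective h.\<close>
      moreover have "h p \<notin> \<alpha> ` rays n"
      proof
        assume hp: "h p \<in> \<alpha> ` rays n"
        then have "h (h p) = h p" using fix_image h by simp
        then have "h p = p"
          using injection_monoid_inj[OF hM, of "h p" p] \<open>h p \<in> rays n\<close> p by (simp add: F_def)
        then show False using hp p by (simp add: F_def)
      qed
      ultimately show ?thesis by (simp add: F_def)
    qed
    then show "restrict h F \<in> F \<rightarrow>\<^sub>E F" by auto
  qed
  moreover have "finite (F \<rightarrow>\<^sub>E F)"
    using finite_complement_image[OF \<alpha>] by (intro finite_PiE) (auto simp: F_def)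
  moreover have "inj_on (\<lambda>h. restrict h F) ?S"
  proof (rule inj_onI)
    fix h k assume hk: "h \<in> ?S" "k \<in> ?S" "restrict h F = restrict k F"
    show "h = k"
    proof (rule injection_monoid_ext[where n=n])
      fix i x assume "x \<in> {1..n}"
      then have "(i, x) \<in> rays n" by simp
      then show "h (i, x) = k (i, x)"
        using fix_image[OF hk(1)] fix_image[OF hk(2)] fun_cong[OF hk(3), of "(i, x)"]
        by (cases "(i, x) \<in> F") (auto simp: F_def)
    qed (use hk in \<open>auto simp: mem_houghton_group\<close>)
  qed
  ultimately show ?thesis using finite_imageD finite_subset by blast
qed

text \<open>Repeating a positive translation would carry one far point to infinitely many places,
  too many for the finite Q. A negative translation is excluded by passing to the inverse.\<close>

lemma finite_subgroup_eventually_identity: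
  assumes Q: "subgroup Q (houghton_group n)" "finite Q"
  shows "\<exists>z. \<forall>q\<in>Q. \<forall>x\<in>{1..n}. \<forall>i\<ge>z. q (i, x) = (i, x)"
proof -
  have "\<exists>z. \<forall>i\<ge>z. q (i, x) = (i, x)" if q: "q \<in> Q" and x: "x \<in> {1..n}" for q x
  proof -
    have mem: "h \<in> carrier (houghton_group n)" if "h \<in> Q" for h
      using subgroup.subset[OF Q(1)] that by blast
    have no_shift: False if q: "q \<in> Q" and m: "m > 0" "\<forall>i\<ge>z. q (i, x) = (i + m, x)" for q m z
    proof -
      \<comment> \<open>The element h plays the role of the j-th power of q; starting at z keeps the
        whole trajectory in the range where q translates.\<close>
      have *: "\<exists>h\<in>Q. h (z, x) = (z + j * m, x)" for j
      proof (induction j)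
        case 0
        have "(\<lambda>p\<in>rays n. p) \<in> Q" using subgroup.one_closed[OF Q(1)] by simp
        then show ?case using x by (intro bexI[of _ "\<lambda>p\<in>rays n. p"]) auto
      next
        case (Suc j)
        then obtain h where h: "h \<in> Q" "h (z, x) = (z + j * m, x)" by blast
        then have "compose (rays n) q h \<in> Q" using subgroup.m_closed[OF Q(1) h(1) q] by simp
        moreover have "compose (rays n) q h (z, x) = (z + Suc j * m, x)"
          using h m x by (simp add: compose_def)
        ultimately show ?case by blast
      qed
      have "range (\<lambda>j. (z + j * m, x)) \<subseteq> (\<lambda>h. h (z, x)) ` Q"
      proof clarify
        fix j
        obtain h where "h \<in> Q" "h (z, x) = (z + j * m, x)" using * by blast
        then show "(z + j * m, x) \<in> (\<lambda>h. h (z, x)) ` Q" by (metis image_eqI)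
      qed
      then have "finite (range (\<lambda>j. (z + j * m, x)))"
        using \<open>finite Q\<close> by (metis finite_imageI finite_subset)
      moreover have "inj (\<lambda>j. (z + j * m, x))" using m by (auto simp: inj_def)
      ultimately show False using finite_imageD by blast
    qed
    obtain z m where zm: "\<And>x i. \<lbrakk>x \<in> {1..n}; z x \<le> i\<rbrakk> \<Longrightarrow> 0 \<le> int i + m x \<and> q (i, x) = (nat (int i + m x), x)"
      using mem[OF q] eventually_translationE by (metis mem_injection_monoid mem_houghton_group)
    have "m x \<le> 0"
    proof (rule ccontr)
      assume m: "\<not> m x \<le> 0"
      have "q (i, x) = (i + nat (m x), x)" if "i \<ge> z x" for i
        using zm[OF x that] m by (simp add: nat_add_distrib)
      then show False using no_shift[OF q, of "nat (m x)" "z x"] m by simp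
    qed
    moreover have "m x \<ge> 0"
    proof (rule ccontr)
      assume m: "\<not> m x \<ge> 0"
      define q' where "q' = inv\<^bsub>houghton_group n\<^esub> q"
      have q': "q' \<in> Q" unfolding q'_def using subgroup.m_inv_closed[OF Q(1) q] .
      have "compose (rays n) q' q = (\<lambda>p\<in>rays n. p)"
        using group.r_inv[OF group_houghton_group mem[OF q]] by (simp add: q'_def)
      then have inv: "q' (q p) = p" if "p \<in> rays n" for p
        using that by (metis compose_eq restrict_apply')
      have "q' (i, x) = (i + nat (- m x), x)" if "i \<ge> z x" for i
      proof -
        have "q (i + nat (- m x), x) = (i, x)"
          using zm[OF x, of "i + nat (- m x)"] that m by simp
        then show ?thesis using inv[of "(i + nat (- m x), x)"] x by simp
      qed
      then show False using no_shift[OF q', of "nat (- m x)" "z x"] m by simp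
    qed
    ultimately show ?thesis using zm[OF x] by (intro exI[of _ "z x"]) simp
  qed
  then obtain z where z: "\<And>q x i. \<lbrakk>q \<in> Q; x \<in> {1..n}; z q x \<le> i\<rbrakk> \<Longrightarrow> q (i, x) = (i, x)"
    by metis
  \<comment> \<open>The sum of all thresholds is a bound uniform in q and x.\<close>
  have "z q x \<le> (\<Sum>q\<in>Q. \<Sum>x\<in>{1..n}. z q x)" if "q \<in> Q" "x \<in> {1..n}" for q x
    using that \<open>finite Q\<close> by (meson finite_atLeastAtMost member_le_sum order_trans zero_le)
  then show ?thesis
    using z by (meson order_trans)
qed

section \<open>Fixed points and isotropy\<close>

text \<open>If \<phi> v < v, then \<phi> maps the down-set of v in \<sigma> injectively into that of
  \<phi> v, which is strictly smaller: impossible for finite sets.\<close>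

lemma chain_map_no_descent:
  assumes r: "antisym r" "trans r" and "finite \<sigma>" and chain: "\<sigma> \<in> Chains r"
    and mono: "\<And>u v. \<lbrakk>u \<in> \<sigma>; v \<in> \<sigma>; (u, v) \<in> r\<rbrakk> \<Longrightarrow> (\<phi> u, \<phi> v) \<in> r"
    and inj: "inj_on \<phi> \<sigma>" and \<phi>: "\<phi> ` \<sigma> \<subseteq> \<sigma>" and v: "v \<in> \<sigma>" "(\<phi> v, v) \<in> r"
  shows "\<phi> v = v"
proof (rule ccontr)
  assume "\<phi> v \<noteq> v"
  define D where "D v = {u \<in> \<sigma>. (u, v) \<in> r}" for v
  have fin: "finite (D w)" for w using \<open>finite \<sigma>\<close> by (simp add: D_def)
  have "card (D v) = card (\<phi> ` D v)"
    by (rule card_image[symmetric], rule inj_on_subset[OF inj]) (auto simp: D_def)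
  also have "\<dots> \<le> card (D (\<phi> v))"
    using mono v \<phi> by (intro card_mono fin) (auto simp: D_def)
  also have "\<dots> < card (D v)"
  proof (intro psubset_card_mono fin psubsetI)
    show "D (\<phi> v) \<subseteq> D v" using v transD[OF r(2)] by (auto simp: D_def)
    have "v \<in> D v" using chain v by (auto simp: D_def Chains_def)
    moreover have "v \<notin> D (\<phi> v)" using antisymD[OF r(1)] v \<open>\<phi> v \<noteq> v\<close> by (auto simp: D_def)
    ultimately show "D (\<phi> v) \<noteq> D v" by blast
  qed
  finally show False by simp
qed

lemma chain_automorphism_trivial:
  assumes r: "antisym r" "trans r" and fin: "finite \<sigma>" and chain: "\<sigma> \<in> Chains r"
    and mono: "\<And>u v. \<lbrakk>u \<in> \<sigma>; v \<in> \<sigma>; (u, v) \<in> r\<rbrakk> \<Longrightarrow> (\<phi> u, \<phi> v) \<in> r"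
    and \<phi>: "\<phi> ` \<sigma> = \<sigma>" and v: "v \<in> \<sigma>"
  shows "\<phi> v = v"
proof -
  have inj: "inj_on \<phi> \<sigma>" using fin \<phi> by (simp add: eq_card_imp_inj_on)
  have "\<phi> v \<in> \<sigma>" using \<phi> v by blast
  then consider "(\<phi> v, v) \<in> r" | "(v, \<phi> v) \<in> r" using chain v by (auto simp: Chains_def)
  then show ?thesis
  proof cases
    case 1
    show ?thesis by (rule chain_map_no_descent[OF r fin chain mono inj _ v 1]) (use \<phi> in auto)
  next
    case 2
    \<comment> \<open>An ascent is a descent for the reversed order, for which \<phi> is monotone as
      well.\<close>
    have "antisym (r\<inverse>)" "trans (r\<inverse>)" "\<sigma> \<in> Chains (r\<inverse>)" using r chain by (auto simp: Chains_def)
    then show ?thesis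
      by (rule chain_map_no_descent[OF _ _ fin _ _ inj _ v]) (use mono \<phi> 2 in auto)
  qed
qed

abbreviation vertex_action :: "nat \<Rightarrow> (point \<Rightarrow> point) \<Rightarrow> (point \<Rightarrow> point) \<Rightarrow> point \<Rightarrow> point" where
  "vertex_action n \<alpha> g \<equiv> compose (rays n) g \<alpha>"

lemma Union_order_complex: "\<Union> (order_complex (injection_order n)) = carrier (injection_monoid n)"
proof
  show "\<Union> (order_complex (injection_order n)) \<subseteq> carrier (injection_monoid n)"
    using order_complex_Field[of _ "injection_order n"] by (auto simp: Field_injection_order)
  show "carrier (injection_monoid n) \<subseteq> \<Union> (order_complex (injection_order n))"
  proof
    fix \<alpha> assume "\<alpha> \<in> carrier (injection_monoid n)"
    then have "{\<alpha>} \<in> order_complex (injection_order n)"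
      using injection_order_refl by (simp add: order_complex_def Chains_def)
    then show "\<alpha> \<in> \<Union> (order_complex (injection_order n))" by blast
  qed
qed

lemma houghton_regular_complex_action:
  "regular_complex_action (houghton_group n) (order_complex (injection_order n)) (vertex_action n)"
proof (intro regular_complex_action.intro regular_complex_action_axioms.intro group_houghton_group;
    (unfold Union_order_complex houghton_group_mult houghton_group_one)?)
  fix \<sigma> \<tau> assume "\<sigma> \<in> order_complex (injection_order n)"
  then show "finite \<sigma>" by (rule order_complex_finite)
next
  fix \<sigma> \<tau> assume "\<sigma> \<in> order_complex (injection_order n)" "\<tau> \<subseteq> \<sigma>" "\<tau> \<noteq> {}"
  then show "\<tau> \<in> order_complex (injection_order n)" by (rule order_complex_face)
next
  fix \<sigma> g assume "\<sigma> \<in> order_complex (injection_order n)" "g \<in> carrier (houghton_group n)"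
  then show "(\<lambda>v. vertex_action n v g) ` \<sigma> \<in> order_complex (injection_order n)"
    using order_complex_image[of \<sigma> "injection_order n" "\<lambda>v. vertex_action n v g"]
      injection_order_mult by (simp add: mem_houghton_group)
next
  fix \<alpha> assume "\<alpha> \<in> carrier (injection_monoid n)"
  then show "vertex_action n \<alpha> (\<lambda>p\<in>rays n. p) = \<alpha>" by (rule compose_one_right)
next
  fix \<alpha> g h assume "\<alpha> \<in> carrier (injection_monoid n)"
  then show "vertex_action n \<alpha> (compose (rays n) h g) = vertex_action n (vertex_action n \<alpha> g) h"
    by (rule compose_assoc_rays)
next
  fix \<sigma> g \<alpha> assume \<sigma>: "\<sigma> \<in> order_complex (injection_order n)" and g: "g \<in> carrier (houghton_group n)"
    and "(\<lambda>v. vertex_action n v g) ` \<sigma> = \<sigma>" "\<alpha> \<in> \<sigma>"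
  then show "vertex_action n \<alpha> g = \<alpha>"
    using chain_automorphism_trivial[OF antisym_injection_order trans_injection_order, of \<sigma> n "\<lambda>v. vertex_action n v g" \<alpha>]
      injection_order_mult by (simp add: order_complex_def mem_houghton_group)
qed

definition fixed_injections :: "nat \<Rightarrow> (point \<Rightarrow> point) set \<Rightarrow> (point \<Rightarrow> point) set" where
  "fixed_injections n Q = {\<alpha> \<in> carrier (injection_monoid n). \<forall>q\<in>Q. compose (rays n) q \<alpha> = \<alpha>}"

text \<open>Going up precomposes with a shift while Q acts after the map, so by associativity
  invariance survives.\<close>

lemma fixed_injections_upward:
  assumes "\<alpha> \<in> fixed_injections n Q" "(\<alpha>, \<beta>) \<in> injection_order n"
  shows "\<beta> \<in> fixed_injections n Q"
proof -
  obtain a where \<beta>: "\<beta> = compose (rays n) \<alpha> (multi_shift n a)"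
    using assms(2) unfolding injection_order_iff by blast
  have "compose (rays n) q \<beta> = \<beta>" if "q \<in> Q" for q
    unfolding \<beta> compose_assoc_rays[OF multi_shift_in_injection_monoid, symmetric]
    using assms(1) that by (simp add: fixed_injections_def)
  then show ?thesis
    using assms(2) by (simp add: fixed_injections_def injection_order_iff_apply)
qed

lemma fixed_injections_nonempty:
  assumes Q: "subgroup Q (houghton_group n)" "finite Q"
  shows "fixed_injections n Q \<noteq> {}"
proof -
  obtain z where z: "\<forall>q\<in>Q. \<forall>x\<in>{1..n}. \<forall>i\<ge>z. q (i, x) = (i, x)"
    using finite_subgroup_eventually_identity[OF Q] by blast
  \<comment> \<open>Shifting every ray by z lands where all elements of Q are the identity.\<close>
  have "compose (rays n) q (multi_shift n (\<lambda>x. z)) = multi_shift n (\<lambda>x. z)" if q: "q \<in> Q" for q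
  proof -
    have "q \<in> carrier (injection_monoid n)"
      using subgroup.subset[OF Q(1)] q by (auto simp: mem_houghton_group)
    then show ?thesis
      using z q by (intro injection_monoid_ext[where n=n] injection_monoid_compose multi_shift_in_injection_monoid)
        (simp_all add: compose_eq)
  qed
  then have "multi_shift n (\<lambda>x. z) \<in> fixed_injections n Q"
    using multi_shift_in_injection_monoid by (simp add: fixed_injections_def)
  then show ?thesis by blast
qed

lemma Field_fixed_order:
  assumes "U \<subseteq> carrier (injection_monoid n)"
  shows "Field (Restr (injection_order n) U) = U"
  using assms injection_order_refl by (fastforce simp: Field_def)

lemma contractible_fixed_injections:
  "contractible_space (geometric_realisation (order_complex
     (Restr (injection_order n) (fixed_injections n Q))))"
proof (rule contractible_realisation_join_semilattice)
  let ?U = "fixed_injections n Q" and ?r = "Restr (injection_order n) (fixed_injections n Q)"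
  have U: "?U \<subseteq> carrier (injection_monoid n)" by (auto simp: fixed_injections_def)
  show "refl_on (Field ?r) ?r"
    unfolding Field_fixed_order[OF U] using U injection_order_refl by (auto simp: refl_on_def)
  show "antisym ?r" by (rule antisym_subset[OF _ antisym_injection_order[of n]]) blast
  show "trans ?r" by (rule trans_Restr[OF trans_injection_order])
  fix \<alpha> \<beta> assume "\<alpha> \<in> Field ?r" "\<beta> \<in> Field ?r"
  then have mem: "\<alpha> \<in> ?U" "\<beta> \<in> ?U" by (simp_all add: Field_fixed_order[OF U])
  then obtain \<gamma> where \<gamma>: "(\<alpha>, \<gamma>) \<in> injection_order n" "(\<beta>, \<gamma>) \<in> injection_order n"
    "\<And>\<delta>. \<lbrakk>(\<alpha>, \<delta>) \<in> injection_order n; (\<beta>, \<delta>) \<in> injection_order n\<rbrakk> \<Longrightarrow> (\<gamma>, \<delta>) \<in> injection_order n"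
    using injection_order_join[of \<alpha> n \<beta>] U by blast
  \<comment> \<open>The join taken in the whole monoid is above a fixed injection, hence itself
    fixed; so it is also the join in the restricted order.\<close>
  moreover have "\<gamma> \<in> ?U" using fixed_injections_upward mem(1) \<gamma>(1) by blast
  ultimately show "\<exists>\<gamma>. (\<alpha>, \<gamma>) \<in> ?r \<and> (\<beta>, \<gamma>) \<in> ?r \<and>
      (\<forall>\<delta>. (\<alpha>, \<delta>) \<in> ?r \<and> (\<beta>, \<delta>) \<in> ?r \<longrightarrow> (\<gamma>, \<delta>) \<in> ?r)"
    using mem by blast
qed

theorem mainTheorem17:
  fixes n :: nat
  assumes "n > 1"
  shows "model_for_E_Fin (houghton_group n) (poset_realisation n) (poset_realisation_action n)"
proof -
  let ?G = "houghton_group n" and ?r = "injection_order n"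
  interpret regular_complex_action ?G "order_complex ?r" "vertex_action n"
    by (rule houghton_regular_complex_action)
  have X: "poset_realisation n = X" by (simp add: poset_realisation_def)
  have act: "poset_realisation_action n = act"
    by (simp add: poset_realisation_action_def act_def fun_eq_iff)
  have support_carrier: "support x \<subseteq> carrier (injection_monoid n)" if "x \<in> topspace X" for x
    using support_X(1)[OF that] Union_order_complex by blast
  have isotropy: "finite (isotropy_group ?G act x)" if x: "x \<in> topspace X" for x
  proof -
    \<comment> \<open>An element fixing x fixes every vertex of its support, so the finite
      stabiliser of any one vertex bounds the isotropy group.\<close>
    obtain \<alpha> where \<alpha>: "\<alpha> \<in> support x" using support_nonempty[OF support_X(2)[OF x]] by blast
    have "isotropy_group ?G act x \<subseteq> {g \<in> carrier ?G. compose (rays n) g \<alpha> = \<alpha>}"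
      using act_eq_iff[OF x] \<alpha> by (auto simp: isotropy_group_def)
    then show ?thesis
      using finite_stabiliser[of \<alpha> n] support_carrier[OF x] \<alpha> by (auto intro: finite_subset)
  qed
  have fixed: "topspace (fixed_point_space X act Q) \<noteq> {} \<and> contractible_space (fixed_point_space X act Q)"
    if Q: "subgroup Q ?G" "finite Q" for Q
  proof -
    let ?U = "fixed_injections n Q"
    let ?L = "order_complex (Restr ?r ?U)"
    have QG: "q \<in> carrier ?G" if "q \<in> Q" for q using subgroup.subset[OF Q(1)] that by blast
    have U: "?U \<subseteq> carrier (injection_monoid n)" by (auto simp: fixed_injections_def)
    have L: "\<sigma> \<in> ?L \<longleftrightarrow> \<sigma> \<in> order_complex ?r \<and> \<sigma> \<subseteq> ?U" for \<sigma>
      by (auto simp: order_complex_def Chains_def)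
    \<comment> \<open>A point is fixed exactly when all vertices of its support are, so the fixed
      set is the full subcomplex on the fixed injections and carries its own weak topology.\<close>
    have "{x \<in> topspace X. \<forall>q\<in>Q. act x q = x} = \<Union> (geometric_simplex ` ?L)"
    proof (intro equalityI subsetI)
      fix x assume "x \<in> {x \<in> topspace X. \<forall>q\<in>Q. act x q = x}"
      then have x: "x \<in> topspace X" "\<forall>q\<in>Q. act x q = x" by auto
      then have "support x \<subseteq> ?U"
        using act_eq_iff[OF x(1) QG] support_carrier[OF x(1)] by (auto simp: fixed_injections_def)
      then show "x \<in> \<Union> (geometric_simplex ` ?L)"
        using support_X[OF x(1)] L by blast
    next
      fix x assume "x \<in> \<Union> (geometric_simplex ` ?L)"
      then obtain \<sigma> where \<sigma>: "\<sigma> \<in> order_complex ?r" "\<sigma> \<subseteq> ?U" "x \<in> geometric_simplex \<sigma>" using L by blast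
      then have x: "x \<in> topspace X" by auto
      have "support x \<subseteq> ?U" using geometric_simplexD(4)[OF \<sigma>(3)] \<sigma>(2) by blast
      then have "act x q = x" if "q \<in> Q" for q
        using act_eq_iff[OF x QG[OF that]] that by (auto simp: fixed_injections_def)
      then show "x \<in> {x \<in> topspace X. \<forall>q\<in>Q. act x q = x}" using x by blast
    qed
    moreover have "subtopology X (\<Union> (geometric_simplex ` ?L)) = geometric_realisation ?L"
      by (rule subtopology_subcomplex) (auto simp: L order_complex_finite intro: order_complex_face)
    ultimately have eq: "fixed_point_space X act Q = geometric_realisation ?L"
      by (simp add: fixed_point_space_def)
    obtain \<alpha> where \<alpha>: "\<alpha> \<in> ?U" using fixed_injections_nonempty[OF Q] by blast
    then have "{\<alpha>} \<in> ?L" using U injection_order_refl by (auto simp: order_complex_def Chains_def)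
    moreover have "(\<lambda>v. if v = \<alpha> then 1 else 0) \<in> geometric_simplex {\<alpha>}"
      by (simp add: geometric_simplex_def)
    ultimately have "topspace (geometric_realisation ?L) \<noteq> {}" by auto
    then show ?thesis using contractible_fixed_injections by (simp add: eq)
  qed
  show ?thesis
    unfolding model_for_E_Fin_def X act using G_CW_complex_realisation isotropy fixed by blast
qed

end
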